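(* The operator spaces $R$, $C$, and $\mathrm{OH}$ are incomparable with respect to almost complete coarse embeddability of bounded subsets; that is, for any two distinct members $X,Y$ of the list $R,C,\mathrm{OH}$, the bounded subsets of $X$ do not almost completely coarsely embed into $Y$.
   Context: An operator space is a closed linear subspace $X$ of $\mathcal{B}(H)$ for some complex Hilbert space $H$. For $n\in\mathbb{N}$, $\mathrm{M}_n(X)$ is the space of $n\times n$ matrices over $X$ with the norm inherited from $\mathrm{M}_n(\mathcal{B}(H))\cong\mathcal{B}(H^{\oplus n})$. For a (not necessarily linear) map $f$ defined on a set $A$, its $n$-th amplification $f_n$ is defined on $\mathrm{M}_n(A)$ by $f_n([x_{ij}])=[f(x_{ij})]$. $B_E$ denotes the closed unit ball of a Banach space $E$. A sequence $\bar f=(F^n\colon A_n\to B_n)_n$ of maps between metric spaces $(A_n,d_n)$, $(B_n,\partial_n)$ is an equi-coarse embedding (the maps are equi-coarse embeddings) if $\omega_{\bar f}(t)<\infty$ for all $t\ge 0$ and $\lim_{t\to\infty}\rho_{\bar f}(t)=\infty$, where $\omega_{\bar f}(t)=\sup_n\sup\{\partial_n(F^n(x),F^n(y))\mid d_n(x,y)\le t\}$ and $\rho_{\bar f}(t)=\inf_n\inf\{\partial_n(F^n(x),F^n(y))\mid d_n(x,y)\ge t\}$ (with $\inf\emptyset=\infty$). For operator spaces $X,Y$, the bounded subsets of $X$ almost completely coarsely embed into $Y$ if there is a sequence of maps $(f^n\colon n\cdot B_X\to Y)_n$ such that the restricted amplifications $(f^n_n\restriction_{n\cdot B_{\mathrm{M}_n(X)}}\colon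 n\cdot B_{\mathrm{M}_n(X)}\to\mathrm{M}_n(Y))_{n=1}^\infty$ are equi-coarse embeddings (note $n\cdot B_{\mathrm{M}_n(X)}\subset\mathrm{M}_n(n\cdot B_X)$). Let $e_{i,j}\in\mathcal{B}(\ell_2)$ be the operator whose $(i,j)$-coordinate is $1$ and all others are $0$. Then $R=\overline{\mathrm{span}}\{e_{1,j}\mid j\in\mathbb{N}\}$ is the row operator space and $C=\overline{\mathrm{span}}\{e_{j,1}\mid j\in\mathbb{N}\}$ is the column operator space. $\mathrm{OH}$ is Pisier's operator Hilbert space: completely isometrically $\mathrm{OH}=(R,C)_{1/2}$, the complex interpolation space of $R$ and $C$ (both identified canonically with $\ell_2$), with $\mathrm{M}_n((R,C)_{1/2})=(\mathrm{M}_n(R),\mathrm{M}_n(C))_{1/2}$ for all $n$. *)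

theory Defs
  imports "HOL-Analysis.Analysis" "HOL-Library.Function_Algebras"
begin

section \<open>Complex vector spaces and complex Hilbert spaces\<close>

class complex_vector = ab_group_add +
  fixes scaleC :: "complex \<Rightarrow> 'a \<Rightarrow> 'a"  (infixr "*\<^sub>C" 75)
  assumes scaleC_add_right: "c *\<^sub>C (x + y) = c *\<^sub>C x + c *\<^sub>C y"
    and scaleC_add_left: "(c + d) *\<^sub>C x = c *\<^sub>C x + d *\<^sub>C x"
    and scaleC_scaleC: "c *\<^sub>C (d *\<^sub>C x) = (c * d) *\<^sub>C x"
    and scaleC_one: "1 *\<^sub>C x = x"

global_interpretation complex_vector: vector_space "scaleC :: complex \<Rightarrow> 'a \<Rightarrow> 'a::complex_vector"
  defines cspan = complex_vector.span
  by unfold_locales (simp_all add: scaleC_add_right scaleC_add_left scaleC_scaleC scaleC_one)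

class complex_normed_vector = complex_vector + real_normed_vector +
  assumes scaleR_scaleC: "r *\<^sub>R x = complex_of_real r *\<^sub>C x"
    and norm_scaleC: "norm (c *\<^sub>C x) = cmod c * norm x"

text \<open>The norm is induced by the real inner product, and multiplication by complex scalars is
  isometric for it, so the complex inner product is determined by polarisation.\<close>

class complex_hilbert_space = complex_normed_vector + real_inner + complete_space

instantiation "fun" :: (type, complex_vector) complex_vector
begin
definition "scaleC c f = (\<lambda>x. c *\<^sub>C f x)"
instance
  by standard (simp_all add: scaleC_fun_def fun_eq_iff scaleC_add_right scaleC_add_left
      scaleC_scaleC scaleC_one)
end

lemma bounded_linear_scaleC: "bounded_linear (scaleC c :: 'a \<Rightarrow> 'a::complex_normed_vector)"
  by (rule bounded_linear_intro[where K = "cmod c"])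
    (simp_all add: scaleC_add_right scaleR_scaleC scaleC_scaleC norm_scaleC mult.commute)

instantiation blinfun :: (real_normed_vector, complex_normed_vector) complex_normed_vector
begin
lift_definition scaleC_blinfun :: "complex \<Rightarrow> ('a \<Rightarrow>\<^sub>L 'b) \<Rightarrow> ('a \<Rightarrow>\<^sub>L 'b)"
  is "\<lambda>c T x. c *\<^sub>C T x"
  by (rule bounded_linear_compose[OF bounded_linear_scaleC])
instance
proof
  fix c d :: complex and r :: real and S T :: "'a \<Rightarrow>\<^sub>L 'b"
  show "c *\<^sub>C (S + T) = c *\<^sub>C S + c *\<^sub>C T"
    by transfer (simp add: scaleC_add_right)
  show "(c + d) *\<^sub>C T = c *\<^sub>C T + d *\<^sub>C T"
    by transfer (simp add: scaleC_add_left)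
  show "c *\<^sub>C (d *\<^sub>C T) = (c * d) *\<^sub>C T"
    by transfer (simp add: scaleC_scaleC)
  show "1 *\<^sub>C T = T"
    by transfer (simp add: scaleC_one)
  show "r *\<^sub>R T = complex_of_real r *\<^sub>C T"
    by transfer (simp add: scaleR_scaleC)
  have le: "norm (a *\<^sub>C U) \<le> cmod a * norm U" for a and U :: "'a \<Rightarrow>\<^sub>L 'b"
    by (rule norm_blinfun_bound)
      (simp_all add: scaleC_blinfun.rep_eq norm_scaleC mult.assoc norm_blinfun mult_left_mono)
  show "norm (c *\<^sub>C T) = cmod c * norm T"
  proof (cases "c = 0")
    case True
    then show ?thesis using le[of c T] by simp
  next
    case False
    have "norm T = norm (inverse c *\<^sub>C (c *\<^sub>C T))"
      using False \<open>1 *\<^sub>C T = T\<close> by (transfer fixing: c) (simp add: scaleC_scaleC scaleC_one)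
    also have "\<dots> \<le> cmod (inverse c) * norm (c *\<^sub>C T)" by (rule le)
    finally have "cmod c * norm T \<le> norm (c *\<^sub>C T)"
      using False by (simp add: norm_inverse norm_divide field_simps)
    with le[of c T] show ?thesis by simp
  qed
qed
end


section \<open>The Hilbert space of square-summable complex sequences\<close>

typedef ell2 = "{x :: nat \<Rightarrow> complex. summable (\<lambda>k. (cmod (x k))\<^sup>2)}"
  morphisms coord Abs_ell2
  by (rule exI[of _ "\<lambda>_. 0"]) simp

setup_lifting type_definition_ell2

lemma ell2_eqI: "(\<And>k. coord x k = coord y k) \<Longrightarrow> x = y"
  by (metis coord_inject ext)

lemma summable_coord: "summable (\<lambda>k. (cmod (coord x k))\<^sup>2)"
  using coord[of x] by simp

lemma ell2_add_closed:
  assumes "summable (\<lambda>k. (cmod (x k))\<^sup>2)" "summable (\<lambda>k. (cmod (y k))\<^sup>2)"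
  shows "summable (\<lambda>k. (cmod (x k + y k))\<^sup>2)"
proof (rule summable_comparison_test')
  show "summable (\<lambda>k. 2 * (cmod (x k))\<^sup>2 + 2 * (cmod (y k))\<^sup>2)"
    using assms by (intro summable_add summable_mult)
  fix k :: nat
  have "(cmod (x k + y k))\<^sup>2 \<le> (cmod (x k) + cmod (y k))\<^sup>2"
    by (intro power_mono norm_triangle_ineq) simp
  also have "\<dots> \<le> 2 * (cmod (x k))\<^sup>2 + 2 * (cmod (y k))\<^sup>2"
    using sum_squares_bound[of "cmod (x k)" "cmod (y k)"] by (simp add: power2_sum)
  finally show "norm ((cmod (x k + y k))\<^sup>2) \<le> 2 * (cmod (x k))\<^sup>2 + 2 * (cmod (y k))\<^sup>2"
    by simp
qed

lemma ell2_scale_closed: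
  "summable (\<lambda>k. (cmod (x k))\<^sup>2) \<Longrightarrow> summable (\<lambda>k. (cmod (c * x k))\<^sup>2)"
  by (simp add: norm_mult power_mult_distrib summable_mult)

lemma summable_coord_inner: "summable (\<lambda>k. coord x k \<bullet> coord y k)"
proof (rule summable_comparison_test')
  show "summable (\<lambda>k. (cmod (coord x k))\<^sup>2 + (cmod (coord y k))\<^sup>2)"
    by (intro summable_add summable_coord)
  fix k :: nat
  have "\<bar>coord x k \<bullet> coord y k\<bar> \<le> cmod (coord x k) * cmod (coord y k)"
    by (rule Cauchy_Schwarz_ineq2)
  also have "\<dots> \<le> (cmod (coord x k))\<^sup>2 + (cmod (coord y k))\<^sup>2"
    using sum_squares_bound[of "cmod (coord x k)" "cmod (coord y k)"]
      mult_nonneg_nonneg[OF norm_ge_zero norm_ge_zero, of "coord x k" "coord y k"] by linarith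
  finally show "norm (coord x k \<bullet> coord y k) \<le> (cmod (coord x k))\<^sup>2 + (cmod (coord y k))\<^sup>2"
    by simp
qed

instantiation ell2 :: complex_vector
begin
lift_definition zero_ell2 :: ell2 is "\<lambda>_. 0" by simp
lift_definition plus_ell2 :: "ell2 \<Rightarrow> ell2 \<Rightarrow> ell2" is "\<lambda>x y k. x k + y k"
  by (rule ell2_add_closed)
lift_definition uminus_ell2 :: "ell2 \<Rightarrow> ell2" is "\<lambda>x k. - x k" by simp
lift_definition minus_ell2 :: "ell2 \<Rightarrow> ell2 \<Rightarrow> ell2" is "\<lambda>x y k. x k - y k"
  using ell2_add_closed[of _ "\<lambda>k. - _ k"] by simp
lift_definition scaleC_ell2 :: "complex \<Rightarrow> ell2 \<Rightarrow> ell2" is "\<lambda>c x k. c * x k"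
  by (rule ell2_scale_closed)
instance
  by standard (transfer; simp add: algebra_simps fun_eq_iff)+
end

instantiation ell2 :: real_inner
begin
definition "r *\<^sub>R (x :: ell2) = complex_of_real r *\<^sub>C x"
definition "x \<bullet> y = (\<Sum>k. coord x k \<bullet> coord y k)"
definition "norm (x :: ell2) = sqrt (x \<bullet> x)"
definition "sgn (x :: ell2) = inverse (norm x) *\<^sub>R x"
definition "dist (x :: ell2) y = norm (x - y)"
definition "(uniformity :: (ell2 \<times> ell2) filter) = (INF e\<in>{0<..}. principal {(x, y). dist x y < e})"
definition "open (U :: ell2 set) \<longleftrightarrow>
  (\<forall>x\<in>U. eventually (\<lambda>(x', y). x' = x \<longrightarrow> y \<in> U) uniformity)"
instance
proof
  fix x y z :: ell2 and r s :: real
  show "dist x y = norm (x - y)" by (rule dist_ell2_def)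
  show "sgn x = inverse (norm x) *\<^sub>R x" by (rule sgn_ell2_def)
  show "(uniformity :: (ell2 \<times> ell2) filter) = (INF e\<in>{0<..}. principal {(x, y). dist x y < e})"
    by (rule uniformity_ell2_def)
  show "open U \<longleftrightarrow> (\<forall>x\<in>U. eventually (\<lambda>(x', y). x' = x \<longrightarrow> y \<in> U) uniformity)" for U :: "ell2 set"
    by (rule open_ell2_def)
  show "norm x = sqrt (x \<bullet> x)" by (rule norm_ell2_def)
  show "r *\<^sub>R (x + y) = r *\<^sub>R x + r *\<^sub>R y" "(r + s) *\<^sub>R x = r *\<^sub>R x + s *\<^sub>R x"
    "r *\<^sub>R s *\<^sub>R x = (r * s) *\<^sub>R x" "1 *\<^sub>R x = x"
    by (simp_all add: scaleR_ell2_def scaleC_add_right scaleC_add_left scaleC_scaleC scaleC_one)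
  show "x \<bullet> y = y \<bullet> x" by (simp add: inner_ell2_def inner_commute)
  show "(x + y) \<bullet> z = x \<bullet> z + y \<bullet> z"
    by (simp add: inner_ell2_def plus_ell2.rep_eq inner_add_left suminf_add summable_coord_inner)
  have "(complex_of_real r * a) \<bullet> b = r * (a \<bullet> b)" for a b
    by (simp add: inner_complex_def algebra_simps)
  then show "(r *\<^sub>R x) \<bullet> y = r * (x \<bullet> y)"
    by (simp add: inner_ell2_def scaleR_ell2_def scaleC_ell2.rep_eq suminf_mult
        summable_coord_inner)
  show "0 \<le> x \<bullet> x"
    unfolding inner_ell2_def by (rule suminf_nonneg[OF summable_coord_inner]) simp
  show "x \<bullet> x = 0 \<longleftrightarrow> x = 0"
  proof -
    have "x \<bullet> x = 0 \<longleftrightarrow> (\<forall>k. coord x k = 0)"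
      unfolding inner_ell2_def by (subst suminf_eq_zero_iff[OF summable_coord_inner]) auto
    also have "\<dots> \<longleftrightarrow> x = 0" by transfer auto
    finally show ?thesis .
  qed
qed
end

lemma norm_ell2: "(norm (x :: ell2))\<^sup>2 = (\<Sum>k. (cmod (coord x k))\<^sup>2)"
  by (simp add: power2_norm_eq_inner inner_ell2_def)

instance ell2 :: complex_normed_vector
proof
  fix r :: real and c :: complex and x :: ell2
  show "r *\<^sub>R x = complex_of_real r *\<^sub>C x" by (rule scaleR_ell2_def)
  have "(norm (c *\<^sub>C x))\<^sup>2 = (cmod c * norm x)\<^sup>2"
    by (simp add: norm_ell2 scaleC_ell2.rep_eq norm_mult power_mult_distrib suminf_mult
        summable_coord)
  then show "norm (c *\<^sub>C x) = cmod c * norm x" by simp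
qed

lemma norm_coord_le: "cmod (coord x k) \<le> norm x"
proof (rule power2_le_imp_le)
  show "(cmod (coord x k))\<^sup>2 \<le> (norm x)\<^sup>2"
    using sum_le_suminf[OF summable_coord, of "{k}" x] by (simp add: norm_ell2)
qed simp

lemma ell2_complete:
  fixes X :: "nat \<Rightarrow> ell2"
  assumes "Cauchy X"
  shows "convergent X"
proof -
  have "Cauchy (\<lambda>m. coord (X m) k)" for k
  proof (rule metric_CauchyI)
    fix e :: real assume "e > 0"
    then obtain M where M: "\<forall>m\<ge>M. \<forall>n\<ge>M. dist (X m) (X n) < e"
      using assms unfolding Cauchy_def by blast
    have "dist (coord (X m) k) (coord (X n) k) \<le> dist (X m) (X n)" for m n
      using norm_coord_le[of "X m - X n" k] by (simp add: dist_norm minus_ell2.rep_eq)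
    with M show "\<exists>M. \<forall>m\<ge>M. \<forall>n\<ge>M. dist (coord (X m) k) (coord (X n) k) < e"
      by (meson le_less_trans)
  qed
  then have "\<exists>l. (\<lambda>m. coord (X m) k) \<longlonglongrightarrow> l" for k
    using Cauchy_convergent convergent_def by blast
  then obtain l where l: "\<And>k. (\<lambda>m. coord (X m) k) \<longlonglongrightarrow> l k" by metis
  have part: "(\<Sum>k<K. (cmod (coord (X m) k - l k))\<^sup>2) \<le> e\<^sup>2"
    if "\<forall>m\<ge>M. \<forall>n\<ge>M. dist (X m) (X n) < e" "m \<ge> M" for M e m K
  proof (rule tendsto_upperbound)
    show "(\<lambda>n. \<Sum>k<K. (cmod (coord (X m) k - coord (X n) k))\<^sup>2)
        \<longlonglongrightarrow> (\<Sum>k<K. (cmod (coord (X m) k - l k))\<^sup>2)"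
      by (intro tendsto_intros l)
    show "\<forall>\<^sub>F n in sequentially. (\<Sum>k<K. (cmod (coord (X m) k - coord (X n) k))\<^sup>2) \<le> e\<^sup>2"
      unfolding eventually_sequentially
    proof (intro exI allI impI)
      fix n assume "M \<le> n"
      have "(\<Sum>k<K. (cmod (coord (X m - X n) k))\<^sup>2) \<le> (norm (X m - X n))\<^sup>2"
        unfolding norm_ell2 by (rule sum_le_suminf[OF summable_coord]) auto
      also have "\<dots> \<le> e\<^sup>2"
        using that \<open>M \<le> n\<close> by (intro power_mono) (auto simp: dist_norm less_imp_le)
      finally show "(\<Sum>k<K. (cmod (coord (X m) k - coord (X n) k))\<^sup>2) \<le> e\<^sup>2"
        by (simp add: minus_ell2.rep_eq)
    qed
  qed simp
  have summ: "summable (\<lambda>k. (cmod (coord (X m) k - l k))\<^sup>2)"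
    if "\<forall>m\<ge>M. \<forall>n\<ge>M. dist (X m) (X n) < e" "m \<ge> M" for M e m
    by (rule summableI_nonneg_bounded[where x = "e\<^sup>2"]) (use part[OF that] in auto)
  obtain M where M: "\<forall>m\<ge>M. \<forall>n\<ge>M. dist (X m) (X n) < 1"
    using assms unfolding Cauchy_def by (meson zero_less_one)
  have "summable (\<lambda>k. (cmod (coord (X M) k + - (coord (X M) k - l k)))\<^sup>2)"
    by (rule ell2_add_closed[OF summable_coord]) (use summ[OF M order_refl] in \<open>simp add: norm_minus_commute\<close>)
  then have "summable (\<lambda>k. (cmod (l k))\<^sup>2)" by simp
  then have coordL: "coord (Abs_ell2 l) = l" by (simp add: Abs_ell2_inverse)
  have "X \<longlonglongrightarrow> Abs_ell2 l"
  proof (rule metric_LIMSEQ_I)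
    fix r :: real assume "r > 0"
    then obtain N where N: "\<forall>m\<ge>N. \<forall>n\<ge>N. dist (X m) (X n) < r / 2"
      using assms unfolding Cauchy_def by (meson half_gt_zero)
    have "dist (X m) (Abs_ell2 l) < r" if "m \<ge> N" for m
    proof -
      have "(norm (X m - Abs_ell2 l))\<^sup>2 \<le> (r / 2)\<^sup>2"
        unfolding norm_ell2 minus_ell2.rep_eq coordL
        by (rule suminf_le_const[OF summ[OF N that] part[OF N that]])
      then have "norm (X m - Abs_ell2 l) \<le> r / 2"
        by (rule power2_le_imp_le) (use \<open>r > 0\<close> in simp)
      with \<open>r > 0\<close> show ?thesis by (simp add: dist_norm)
    qed
    then show "\<exists>N. \<forall>m\<ge>N. dist (X m) (Abs_ell2 l) < r" by blast
  qed
  then show ?thesis by (auto simp: convergent_def)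
qed

instance ell2 :: complex_hilbert_space
  by standard (rule ell2_complete)


section \<open>Matrix norms\<close>

text \<open>Matrices are indexed from 0: an \<open>n \<times> n\<close> matrix over \<open>X\<close> has its entries at \<open>i, j < n\<close> and is
  zero elsewhere, so that such a matrix is determined by its entries.\<close>

type_synonym 'a mat = "nat \<Rightarrow> nat \<Rightarrow> 'a"

definition mats :: "nat \<Rightarrow> 'a::zero set \<Rightarrow> 'a mat set" where
  "mats n X = {A. \<forall>i j. if i < n \<and> j < n then A i j \<in> X else A i j = 0}"

definition amplification :: "nat \<Rightarrow> ('a \<Rightarrow> 'b::zero) \<Rightarrow> 'a mat \<Rightarrow> 'b mat" where
  "amplification n f A = (\<lambda>i j. if i < n \<and> j < n then f (A i j) else 0)"

text \<open>The norm of \<open>A\<close> as an operator on the Hilbert space direct sum of \<open>n\<close> copies of \<open>H\<close>.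
  The elements of the latter are the families \<open>(x j)\<close> with \<open>j < n\<close>.\<close>

definition op_mat_norm ::
  "nat \<Rightarrow> ('h::complex_hilbert_space \<Rightarrow>\<^sub>L 'h) mat \<Rightarrow> real" where
  "op_mat_norm n A = (SUP x\<in>{x :: nat \<Rightarrow> 'h. sqrt (\<Sum>j<n. (norm (x j))\<^sup>2) \<le> 1}.
     sqrt (\<Sum>i<n. (norm (\<Sum>j<n. blinfun_apply (A i j) (x j)))\<^sup>2))"

text \<open>A vector space together with a norm on its \<open>n \<times> n\<close> matrices for every \<open>n \<ge> 1\<close>; this is the
  part of the structure of an operator space that the embedding notion below refers to.\<close>

record 'a matrix_normed =
  vecs :: "'a set"
  mat_norm :: "nat \<Rightarrow> 'a mat \<Rightarrow> real"

text \<open>In \<open>'h \<Rightarrow>\<^sub>L 'h\<close> the operators are bounded but only real-linear. The complex-linear ones among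
  them form the algebra of all bounded operators on the complex Hilbert space, with the same norm.\<close>

definition complex_operators :: "('h::complex_hilbert_space \<Rightarrow>\<^sub>L 'h) set" where
  "complex_operators = {T. \<forall>c x. blinfun_apply T (c *\<^sub>C x) = c *\<^sub>C blinfun_apply T x}"

definition is_operator_space :: "('h::complex_hilbert_space \<Rightarrow>\<^sub>L 'h) set \<Rightarrow> bool" where
  "is_operator_space X \<longleftrightarrow> X \<subseteq> complex_operators \<and> complex_vector.subspace X \<and> closed X"

lemma closed_complex_operators: "closed (complex_operators :: ('h::complex_hilbert_space \<Rightarrow>\<^sub>L 'h) set)"
proof -
  have "closed {T :: 'h \<Rightarrow>\<^sub>L 'h. blinfun_apply T (c *\<^sub>C x) = c *\<^sub>C blinfun_apply T x}" for c x
    by (intro closed_Collect_eq continuous_intros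
        bounded_linear.continuous_on[OF bounded_linear_scaleC])
  then show ?thesis
    unfolding complex_operators_def by (intro closed_Collect_all)
qed

lemma is_operator_space_closure_span:
  assumes "S \<subseteq> complex_operators"
  shows "is_operator_space (closure (cspan S))"
proof -
  have sub: "complex_vector.subspace (complex_operators :: ('h::complex_hilbert_space \<Rightarrow>\<^sub>L 'h) set)"
    by (simp add: complex_vector.subspace_def complex_operators_def plus_blinfun.rep_eq
        scaleC_blinfun.rep_eq scaleC_add_right scaleC_scaleC mult.commute)
  have "cspan S \<subseteq> complex_operators"
    by (rule complex_vector.span_minimal[OF assms sub])
  then have 1: "closure (cspan S) \<subseteq> complex_operators"
    by (rule closure_minimal[OF _ closed_complex_operators])
  have 2: "complex_vector.subspace (closure (cspan S))"
    unfolding complex_vector.subspace_def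
  proof (intro conjI ballI allI)
    show "0 \<in> closure (cspan S)"
      using closure_subset complex_vector.span_zero by blast
    fix x c assume x: "x \<in> closure (cspan S)"
    then obtain f where f: "\<And>n. f n \<in> cspan S" "f \<longlonglongrightarrow> x" unfolding closure_sequential by blast
    have "(\<lambda>n. c *\<^sub>C f n) \<longlonglongrightarrow> c *\<^sub>C x"
      by (rule bounded_linear.tendsto[OF bounded_linear_scaleC f(2)])
    then show "c *\<^sub>C x \<in> closure (cspan S)"
      unfolding closure_sequential using complex_vector.span_scale[OF f(1)]
      by (intro CollectI exI[of _ "\<lambda>n. c *\<^sub>C f n"]) simp
    fix y assume y: "y \<in> closure (cspan S)"
    then obtain g where g: "\<And>n. g n \<in> cspan S" "g \<longlonglongrightarrow> y" unfolding closure_sequential by blast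
    show "x + y \<in> closure (cspan S)"
      unfolding closure_sequential
      using complex_vector.span_add[OF f(1) g(1)] tendsto_add[OF f(2) g(2)]
      by (intro CollectI exI[of _ "\<lambda>n. f n + g n"]) simp
  qed
  show ?thesis using 1 2 by (simp add: is_operator_space_def)
qed

definition operator_space ::
  "('h::complex_hilbert_space \<Rightarrow>\<^sub>L 'h) set \<Rightarrow> ('h \<Rightarrow>\<^sub>L 'h) matrix_normed" where
  "operator_space X = \<lparr>vecs = X, mat_norm = op_mat_norm\<rparr>"

definition mat_of :: "'a::zero \<Rightarrow> 'a mat" where
  "mat_of x = (\<lambda>i j. if i = 0 \<and> j = 0 then x else 0)"

definition vec_norm :: "'a::zero matrix_normed \<Rightarrow> 'a \<Rightarrow> real" where
  "vec_norm X x = mat_norm X 1 (mat_of x)"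

text \<open>Transport of a matrix norm structure along a linear map \<open>\<phi>\<close>.\<close>

definition transport :: "('a \<Rightarrow> 'b) \<Rightarrow> 'b matrix_normed \<Rightarrow> 'a matrix_normed" where
  "transport \<phi> X = \<lparr>vecs = {x. \<phi> x \<in> vecs X}, mat_norm = (\<lambda>n A. mat_norm X n (\<lambda>i j. \<phi> (A i j)))\<rparr>"


section \<open>The complex interpolation method\<close>

text \<open>A compatible couple consists of two subspaces \<open>A0\<close>, \<open>A1\<close> of a common vector space with norms
  \<open>N0\<close>, \<open>N1\<close>.\<close>

definition sum_space :: "'v::complex_vector set \<Rightarrow> 'v set \<Rightarrow> 'v set" where
  "sum_space A0 A1 = {a + b | a b. a \<in> A0 \<and> b \<in> A1}"

definition sum_norm ::
  "'v::complex_vector set \<Rightarrow> ('v \<Rightarrow> real) \<Rightarrow> 'v set \<Rightarrow> ('v \<Rightarrow> real) \<Rightarrow> 'v \<Rightarrow> real" where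
  "sum_norm A0 N0 A1 N1 x = Inf {N0 a + N1 b | a b. a \<in> A0 \<and> b \<in> A1 \<and> x = a + b}"

definition strip :: "complex set" where
  "strip = {z. 0 \<le> Re z \<and> Re z \<le> 1}"

text \<open>The space of functions from the strip to \<open>A0 + A1\<close> that are bounded and continuous, analytic
  in the interior, and whose restrictions to the two boundary lines are continuous into \<open>A0\<close> and
  \<open>A1\<close>, respectively, and vanish at infinity there.\<close>

definition calderon_space ::
  "'v::complex_vector set \<Rightarrow> ('v \<Rightarrow> real) \<Rightarrow> 'v set \<Rightarrow> ('v \<Rightarrow> real) \<Rightarrow> (complex \<Rightarrow> 'v) set" where
  "calderon_space A0 N0 A1 N1 = {f.
     (\<forall>z\<in>strip. f z \<in> sum_space A0 A1) \<and>
     (\<exists>K. \<forall>z\<in>strip. sum_norm A0 N0 A1 N1 (f z) \<le> K) \<and>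
     (\<forall>z\<in>strip. ((\<lambda>w. sum_norm A0 N0 A1 N1 (f w - f z)) \<longlongrightarrow> 0) (at z within strip)) \<and>
     (\<forall>z\<in>interior strip. \<exists>D\<in>sum_space A0 A1.
        ((\<lambda>w. sum_norm A0 N0 A1 N1 (inverse (w - z) *\<^sub>C (f w - f z) - D)) \<longlongrightarrow> 0) (at z)) \<and>
     (\<forall>t. f (Complex 0 t) \<in> A0 \<and> ((\<lambda>u. N0 (f (Complex 0 u) - f (Complex 0 t))) \<longlongrightarrow> 0) (at t)) \<and>
     (\<forall>t. f (Complex 1 t) \<in> A1 \<and> ((\<lambda>u. N1 (f (Complex 1 u) - f (Complex 1 t))) \<longlongrightarrow> 0) (at t)) \<and>
     ((\<lambda>t. N0 (f (Complex 0 t))) \<longlongrightarrow> 0) at_infinity \<and>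
     ((\<lambda>t. N1 (f (Complex 1 t))) \<longlongrightarrow> 0) at_infinity}"

definition calderon_norm :: "('v \<Rightarrow> real) \<Rightarrow> ('v \<Rightarrow> real) \<Rightarrow> (complex \<Rightarrow> 'v) \<Rightarrow> real" where
  "calderon_norm N0 N1 f = max (SUP t. N0 (f (Complex 0 t))) (SUP t. N1 (f (Complex 1 t)))"

definition interp_space :: "real \<Rightarrow>
    'v::complex_vector set \<Rightarrow> ('v \<Rightarrow> real) \<Rightarrow> 'v set \<Rightarrow> ('v \<Rightarrow> real) \<Rightarrow> 'v set" where
  "interp_space \<theta> A0 N0 A1 N1 = {f (of_real \<theta>) | f. f \<in> calderon_space A0 N0 A1 N1}"

definition interp_norm :: "real \<Rightarrow>
    'v::complex_vector set \<Rightarrow> ('v \<Rightarrow> real) \<Rightarrow> 'v set \<Rightarrow> ('v \<Rightarrow> real) \<Rightarrow> 'v \<Rightarrow> real" where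
  "interp_norm \<theta> A0 N0 A1 N1 x =
     Inf {calderon_norm N0 N1 f | f. f \<in> calderon_space A0 N0 A1 N1 \<and> f (of_real \<theta>) = x}"

text \<open>Interpolation of operator spaces: the matrix norms are obtained by interpolating the spaces of
  \<open>n \<times> n\<close> matrices.\<close>

definition interpolate ::
  "real \<Rightarrow> 'a::complex_vector matrix_normed \<Rightarrow> 'a matrix_normed \<Rightarrow> 'a matrix_normed" where
  "interpolate \<theta> X Y = \<lparr>
     vecs = interp_space \<theta> (vecs X) (vec_norm X) (vecs Y) (vec_norm Y),
     mat_norm = (\<lambda>n. interp_norm \<theta> (mats n (vecs X)) (mat_norm X n) (mats n (vecs Y)) (mat_norm Y n))\<rparr>"


section \<open>The operator spaces \<open>R\<close>, \<open>C\<close> and \<open>OH\<close>\<close>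

lift_definition unit_vec :: "nat \<Rightarrow> ell2" is "\<lambda>i k. if k = i then 1 else 0"
  by (rule summable_finite[of "{i}" for i]) auto

lift_definition mat_unit :: "nat \<Rightarrow> nat \<Rightarrow> ell2 \<Rightarrow>\<^sub>L ell2" is "\<lambda>i j x. coord x j *\<^sub>C unit_vec i"
proof -
  fix i j
  show "bounded_linear (\<lambda>x. coord x j *\<^sub>C unit_vec i)"
    by (rule bounded_linear_intro[where K = "norm (unit_vec i)"])
      (simp_all add: plus_ell2.rep_eq scaleC_add_left scaleR_scaleC scaleC_ell2.rep_eq
        scaleC_scaleC norm_scaleC mult_right_mono norm_coord_le)
qed

text \<open>\<open>mat_unit i j\<close> is the operator with matrix entry \<open>1\<close> at position \<open>(i, j)\<close>, counted from 0, so
  the first row and the first column have index 0.\<close>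

definition row_space :: "(ell2 \<Rightarrow>\<^sub>L ell2) set" where
  "row_space = closure (cspan (range (\<lambda>j. mat_unit 0 j)))"

definition column_space :: "(ell2 \<Rightarrow>\<^sub>L ell2) set" where
  "column_space = closure (cspan (range (\<lambda>j. mat_unit j 0)))"

lemma mat_unit_complex: "mat_unit i j \<in> complex_operators"
  by (simp add: complex_operators_def mat_unit.rep_eq scaleC_ell2.rep_eq scaleC_scaleC)

lemma is_operator_space_row_space: "is_operator_space row_space"
  and is_operator_space_column_space: "is_operator_space column_space"
  unfolding row_space_def column_space_def
  by (auto intro!: is_operator_space_closure_span mat_unit_complex)

definition R_space :: "(ell2 \<Rightarrow>\<^sub>L ell2) matrix_normed" where
  "R_space = operator_space row_space"

definition C_space :: "(ell2 \<Rightarrow>\<^sub>L ell2) matrix_normed" where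
  "C_space = operator_space column_space"

text \<open>The canonical identifications of \<open>\<ell>\<^sub>2\<close> with the row and the column space; the series converge in
  operator norm.\<close>

definition row_op :: "ell2 \<Rightarrow> (ell2 \<Rightarrow>\<^sub>L ell2)" where
  "row_op a = (\<Sum>j. coord a j *\<^sub>C mat_unit 0 j)"

definition column_op :: "ell2 \<Rightarrow> (ell2 \<Rightarrow>\<^sub>L ell2)" where
  "column_op a = (\<Sum>j. coord a j *\<^sub>C mat_unit j 0)"

lemma ell2_expansion: "(\<lambda>j. coord a j *\<^sub>C unit_vec j) sums a"
proof -
  have co: "coord (\<Sum>j<n. coord a j *\<^sub>C unit_vec j) k = (if k < n then coord a k else 0)" for n k
    by (induction n) (auto simp: zero_ell2.rep_eq plus_ell2.rep_eq scaleC_ell2.rep_eq unit_vec.rep_eq less_Suc_eq)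
  have "(norm (a - (\<Sum>j<n. coord a j *\<^sub>C unit_vec j)))\<^sup>2
     = (\<Sum>k. (cmod (coord a (k + n)))\<^sup>2)" for n
  proof -
    let ?g = "\<lambda>k. (cmod (coord (a - (\<Sum>j<n. coord a j *\<^sub>C unit_vec j)) k))\<^sup>2"
    have "suminf ?g = (\<Sum>k. ?g (k + n)) + (\<Sum>k<n. ?g k)"
      by (rule suminf_split_initial_segment[OF summable_coord])
    also have "\<dots> = (\<Sum>k. (cmod (coord a (k + n)))\<^sup>2)"
      by (simp add: minus_ell2.rep_eq co)
    finally show ?thesis by (simp add: norm_ell2)
  qed
  moreover have "(\<lambda>n. \<Sum>k. (cmod (coord a (k + n)))\<^sup>2) \<longlonglongrightarrow> 0"
    by (rule suminf_exist_split2[OF summable_coord])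
  ultimately have "(\<lambda>n. (norm (a - (\<Sum>j<n. coord a j *\<^sub>C unit_vec j)))\<^sup>2) \<longlonglongrightarrow> 0" by simp
  then have "(\<lambda>n. sqrt ((norm (a - (\<Sum>j<n. coord a j *\<^sub>C unit_vec j)))\<^sup>2)) \<longlonglongrightarrow> sqrt 0"
    by (rule tendsto_real_sqrt)
  then have "(\<lambda>n. norm (a - (\<Sum>j<n. coord a j *\<^sub>C unit_vec j))) \<longlonglongrightarrow> 0"
    by (simp only: real_sqrt_abs abs_norm_cancel real_sqrt_zero)
  then have "(\<lambda>n. a - (\<Sum>j<n. coord a j *\<^sub>C unit_vec j)) \<longlonglongrightarrow> 0"
    by (rule tendsto_norm_zero_cancel)
  from tendsto_diff[OF tendsto_const[of a] this]
  show ?thesis unfolding sums_def by (simp only: diff_diff_eq2 diff_zero add_diff_cancel_left')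
qed

lemma summable_coord_mult: "summable (\<lambda>j. cmod (coord a j * coord x j))"
  "(\<Sum>j. cmod (coord a j * coord x j)) \<le> norm a * norm x"
proof -
  define b where "b z = Abs_ell2 (\<lambda>j. of_real (cmod (coord z j)))" for z
  have b: "coord (b z) = (\<lambda>j. of_real (cmod (coord z j)))" for z
    unfolding b_def by (rule Abs_ell2_inverse) (simp add: summable_coord)
  have nb: "norm (b z) = norm z" for z
    by (rule power2_eq_imp_eq) (simp_all add: norm_ell2 b)
  have eq: "coord (b a) j \<bullet> coord (b x) j = cmod (coord a j * coord x j)" for j
    by (simp add: b norm_mult inner_complex_def)
  show "summable (\<lambda>j. cmod (coord a j * coord x j))"
    using summable_coord_inner[of "b a" "b x"] by (simp add: eq)
  show "(\<Sum>j. cmod (coord a j * coord x j)) \<le> norm a * norm x"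
    using norm_cauchy_schwarz[of "b a" "b x"] by (simp add: inner_ell2_def eq nb)
qed

lemma row_sums:
  "\<exists>T. (\<lambda>j. coord a j *\<^sub>C mat_unit 0 j) sums T \<and>
    (\<forall>x. blinfun_apply T x = (\<Sum>j. coord a j * coord x j) *\<^sub>C unit_vec 0)"
proof -
  define \<Phi> where "\<Phi> a x = (\<Sum>j. coord a j * coord x j) *\<^sub>C unit_vec 0" for a x
  have s: "summable (\<lambda>j. coord a j * coord x j)" for a x
    by (rule summable_norm_cancel[OF summable_coord_mult(1)])
  have n: "norm (\<Phi> a x) \<le> norm x * (norm a * norm (unit_vec 0))" for a x
  proof -
    have "cmod (\<Sum>j. coord a j * coord x j) \<le> norm a * norm x"
      by (rule order_trans[OF summable_norm[OF summable_coord_mult(1)] summable_coord_mult(2)])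
    from mult_right_mono[OF this norm_ge_zero[of "unit_vec 0"]]
    show ?thesis by (simp add: \<Phi>_def norm_scaleC mult_ac)
  qed
  have bl: "bounded_linear (\<Phi> a)" for a
  proof (rule bounded_linear_intro[OF _ _ n])
    show "\<Phi> a (x + y) = \<Phi> a x + \<Phi> a y" for x y
      by (simp add: \<Phi>_def plus_ell2.rep_eq ring_distribs suminf_add[symmetric] s scaleC_add_left)
    show "\<Phi> a (r *\<^sub>R x) = r *\<^sub>R \<Phi> a x" for r x
      using suminf_mult[OF s[of a x], of "of_real r"]
      by (simp add: \<Phi>_def scaleR_scaleC scaleC_ell2.rep_eq scaleC_scaleC mult.left_commute)
  qed
  define T where "T a = Blinfun (\<Phi> a)" for a
  have T: "blinfun_apply (T a) = \<Phi> a" for a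
    unfolding T_def by (rule bounded_linear_Blinfun_apply[OF bl])
  have TC: "T (c *\<^sub>C a) = c *\<^sub>C T a" for c a
    by (rule blinfun_eqI) (simp add: T \<Phi>_def scaleC_blinfun.rep_eq scaleC_ell2.rep_eq mult.assoc suminf_mult s scaleC_scaleC)
  have "bounded_linear T"
  proof (rule bounded_linear_intro[where K = "norm (unit_vec 0)"])
    show "T (a + b) = T a + T b" for a b
      by (rule blinfun_eqI) (simp add: T \<Phi>_def plus_blinfun.rep_eq plus_ell2.rep_eq ring_distribs suminf_add[symmetric] s scaleC_add_left)
    show "T (r *\<^sub>R b) = r *\<^sub>R T b" for r b by (simp add: scaleR_scaleC TC)
    show "norm (T a) \<le> norm a * norm (unit_vec 0)" for a
    proof (rule norm_blinfun_bound)
      show "norm (blinfun_apply (T a) x) \<le> norm a * norm (unit_vec 0) * norm x" for x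
        using n[of a x] by (simp add: T mult_ac)
    qed simp
  qed
  from bounded_linear.sums[OF this ell2_expansion[of a]]
  have "(\<lambda>j. coord a j *\<^sub>C T (unit_vec j)) sums T a" by (simp add: TC)
  moreover have "T (unit_vec j) = mat_unit 0 j" for j
  proof (rule blinfun_eqI)
    fix x
    have "(\<Sum>k. coord (unit_vec j) k * coord x k) = (\<Sum>k\<in>{j}. coord (unit_vec j) k * coord x k)"
      by (rule suminf_finite) (auto simp: unit_vec.rep_eq)
    then show "blinfun_apply (T (unit_vec j)) x = blinfun_apply (mat_unit 0 j) x"
      by (simp add: T \<Phi>_def mat_unit.rep_eq unit_vec.rep_eq)
  qed
  ultimately show ?thesis by (intro exI[of _ "T a"]) (simp add: T \<Phi>_def)
qed

lemma row_op_apply: "blinfun_apply (row_op a) x = (\<Sum>j. coord a j * coord x j) *\<^sub>C unit_vec 0"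
proof -
  obtain T where T: "(\<lambda>j. coord a j *\<^sub>C mat_unit 0 j) sums T"
    "\<forall>x. blinfun_apply T x = (\<Sum>j. coord a j * coord x j) *\<^sub>C unit_vec 0"
    using row_sums[of a] by blast
  then have "row_op a = T" by (simp add: row_op_def sums_iff)
  with T show ?thesis by simp
qed

lemma column_sums:
  "\<exists>T. (\<lambda>j. coord a j *\<^sub>C mat_unit j 0) sums T \<and>
    (\<forall>x. blinfun_apply T x = coord x 0 *\<^sub>C a)"
proof -
  have bl: "bounded_linear (\<lambda>x. coord x 0 *\<^sub>C a)" for a :: ell2
    by (rule bounded_linear_intro[where K = "norm a"])
      (simp_all add: plus_ell2.rep_eq scaleC_add_left scaleR_scaleC scaleC_ell2.rep_eq
        scaleC_scaleC norm_scaleC mult_right_mono norm_coord_le)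
  define T where "T a = Blinfun (\<lambda>x. coord x 0 *\<^sub>C a)" for a :: ell2
  have T: "blinfun_apply (T a) x = coord x 0 *\<^sub>C a" for a x
    unfolding T_def by (simp add: bounded_linear_Blinfun_apply[OF bl])
  have TC: "T (c *\<^sub>C a) = c *\<^sub>C T a" for c a
    by (rule blinfun_eqI) (simp add: T scaleC_blinfun.rep_eq scaleC_scaleC mult.commute)
  have "bounded_linear T"
  proof (rule bounded_linear_intro[where K = 1])
    show "T (a + b) = T a + T b" for a b
      by (rule blinfun_eqI) (simp add: T plus_blinfun.rep_eq scaleC_add_right)
    show "T (r *\<^sub>R b) = r *\<^sub>R T b" for r b by (simp add: scaleR_scaleC TC)
    show "norm (T a) \<le> norm a * 1" for a
      by (rule norm_blinfun_bound) (auto simp: T norm_scaleC mult.commute[of "norm a"] intro!: mult_right_mono norm_coord_le)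
  qed
  from bounded_linear.sums[OF this ell2_expansion[of a]]
  have "(\<lambda>j. coord a j *\<^sub>C T (unit_vec j)) sums T a" by (simp add: TC)
  moreover have "T (unit_vec j) = mat_unit j 0" for j
    by (rule blinfun_eqI) (simp add: T mat_unit.rep_eq)
  ultimately show ?thesis by (intro exI[of _ "T a"]) (simp add: T)
qed

lemma column_op_apply: "blinfun_apply (column_op a) x = coord x 0 *\<^sub>C a"
proof -
  obtain T where T: "(\<lambda>j. coord a j *\<^sub>C mat_unit j 0) sums T"
    "\<forall>x. blinfun_apply T x = coord x 0 *\<^sub>C a"
    using column_sums[of a] by blast
  then have "column_op a = T" by (simp add: column_op_def sums_iff)
  with T show ?thesis by simp
qed

lemma row_op_in_row_space: "row_op a \<in> row_space"
proof -
  have "(\<lambda>n. \<Sum>j<n. coord a j *\<^sub>C mat_unit 0 j) \<longlonglongrightarrow> row_op a"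
  proof -
    have "summable (\<lambda>j. coord a j *\<^sub>C mat_unit 0 j)" using row_sums[of a] sums_summable by blast
    then show ?thesis unfolding row_op_def by (rule summable_LIMSEQ)
  qed
  moreover have "(\<Sum>j<n. coord a j *\<^sub>C mat_unit 0 j) \<in> cspan (range (\<lambda>j. mat_unit 0 j))" for n
    by (intro complex_vector.span_sum complex_vector.span_scale complex_vector.span_base) auto
  ultimately show ?thesis unfolding row_space_def closure_sequential
    by (intro exI[of _ "\<lambda>n. \<Sum>j<n. coord a j *\<^sub>C mat_unit 0 j"]) simp
qed

lemma column_op_in_column_space: "column_op a \<in> column_space"
proof -
  have "(\<lambda>n. \<Sum>j<n. coord a j *\<^sub>C mat_unit j 0) \<longlonglongrightarrow> column_op a"
  proof -
    have "summable (\<lambda>j. coord a j *\<^sub>C mat_unit j 0)" using column_sums[of a] sums_summable by blast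
    then show ?thesis unfolding column_op_def by (rule summable_LIMSEQ)
  qed
  moreover have "(\<Sum>j<n. coord a j *\<^sub>C mat_unit j 0) \<in> cspan (range (\<lambda>j. mat_unit j 0))" for n
    by (intro complex_vector.span_sum complex_vector.span_scale complex_vector.span_base) auto
  ultimately show ?thesis unfolding column_space_def closure_sequential
    by (intro exI[of _ "\<lambda>n. \<Sum>j<n. coord a j *\<^sub>C mat_unit j 0"]) simp
qed

definition OH_space :: "ell2 matrix_normed" where
  "OH_space = interpolate (1 / 2) (transport row_op R_space) (transport column_op C_space)"


section \<open>Coarse embeddings\<close>

text \<open>Sequences of maps \<open>F n\<close> are indexed by \<open>n \<ge> 1\<close>. Suprema and infima are taken in \<open>[0, \<infinity>]\<close>; in
  particular the infimum of the empty set is \<open>\<infinity>\<close>.\<close>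

definition expansion_modulus :: "(nat \<Rightarrow> 'a set) \<Rightarrow> (nat \<Rightarrow> 'a \<Rightarrow> 'a \<Rightarrow> real) \<Rightarrow>
    (nat \<Rightarrow> 'b \<Rightarrow> 'b \<Rightarrow> real) \<Rightarrow> (nat \<Rightarrow> 'a \<Rightarrow> 'b) \<Rightarrow> real \<Rightarrow> ennreal" where
  "expansion_modulus A d e F t = (SUP n\<in>{1..}.
     Sup {ennreal (e n (F n x) (F n y)) | x y. x \<in> A n \<and> y \<in> A n \<and> d n x y \<le> t})"

definition compression_modulus :: "(nat \<Rightarrow> 'a set) \<Rightarrow> (nat \<Rightarrow> 'a \<Rightarrow> 'a \<Rightarrow> real) \<Rightarrow>
    (nat \<Rightarrow> 'b \<Rightarrow> 'b \<Rightarrow> real) \<Rightarrow> (nat \<Rightarrow> 'a \<Rightarrow> 'b) \<Rightarrow> real \<Rightarrow> ennreal" where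
  "compression_modulus A d e F t = (INF n\<in>{1..}.
     Inf {ennreal (e n (F n x) (F n y)) | x y. x \<in> A n \<and> y \<in> A n \<and> d n x y \<ge> t})"

definition equi_coarse_embedding :: "(nat \<Rightarrow> 'a set) \<Rightarrow> (nat \<Rightarrow> 'a \<Rightarrow> 'a \<Rightarrow> real) \<Rightarrow>
    (nat \<Rightarrow> 'b set) \<Rightarrow> (nat \<Rightarrow> 'b \<Rightarrow> 'b \<Rightarrow> real) \<Rightarrow> (nat \<Rightarrow> 'a \<Rightarrow> 'b) \<Rightarrow> bool" where
  "equi_coarse_embedding A d B e F \<longleftrightarrow>
     (\<forall>n\<ge>1. F n \<in> A n \<rightarrow> B n) \<and>
     (\<forall>t\<ge>0. expansion_modulus A d e F t < \<infinity>) \<and>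
     (compression_modulus A d e F \<longlongrightarrow> \<infinity>) at_top"

definition mat_dist :: "'a::ab_group_add matrix_normed \<Rightarrow> nat \<Rightarrow> 'a mat \<Rightarrow> 'a mat \<Rightarrow> real" where
  "mat_dist X n A B = mat_norm X n (A - B)"

definition vec_ball :: "'a::zero matrix_normed \<Rightarrow> real \<Rightarrow> 'a set" where
  "vec_ball X r = {x \<in> vecs X. vec_norm X x \<le> r}"

definition mat_ball :: "'a::zero matrix_normed \<Rightarrow> nat \<Rightarrow> real \<Rightarrow> 'a mat set" where
  "mat_ball X n r = {A \<in> mats n (vecs X). mat_norm X n A \<le> r}"

definition bounded_subsets_almost_completely_coarsely_embed ::
  "'a::ab_group_add matrix_normed \<Rightarrow> 'b::ab_group_add matrix_normed \<Rightarrow> bool" where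
  "bounded_subsets_almost_completely_coarsely_embed X Y \<longleftrightarrow>
     (\<exists>f :: nat \<Rightarrow> 'a \<Rightarrow> 'b.
        (\<forall>n\<ge>1. f n \<in> vec_ball X (real n) \<rightarrow> vecs Y) \<and>
        equi_coarse_embedding (\<lambda>n. mat_ball X n (real n)) (mat_dist X)
          (\<lambda>n. mats n (vecs Y)) (mat_dist Y) (\<lambda>n. amplification n (f n)))"

end

theory Submission
  imports Defs "HOL-Complex_Analysis.Complex_Analysis"
begin

text \<open>
  All three spaces carry the same vectors, those of \<open>\<ell>\<^sub>2\<close>. They are told apart by the norm of a row or a
  column of \<open>n\<close> vectors. In \<open>C\<close> a column \<open>(y i)\<close> with \<open>i < n\<close> has the norm
  \<open>sqrt (\<Sum>i<n. (norm (y i))\<^sup>2)\<close>, which is at least \<open>r * n powr (1/2)\<close> if all entries have norm at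
  least \<open>r\<close>. In \<open>R\<close> a column of \<open>n\<close> orthonormal vectors has norm \<open>1\<close>, independently of \<open>n\<close>. In \<open>OH\<close> the
  exponent lies halfway: a column of orthonormal vectors has a norm of order \<open>n powr (1/4)\<close>, and any
  column with entries of norm at least \<open>r\<close> has a norm of at least \<open>r * n powr (1/4)\<close>. For rows the
  spaces \<open>R\<close> and \<open>C\<close> change places.

  A linear embedding that is bounded below would have to respect these exponents. A coarse embedding
  has no control over a single vector of small norm, but its amplifications have: the \<open>k \<times> k\<close> matrix with all
  entries equal to \<open>x\<close> has the norm \<open>k * norm x\<close> (up to a factor of at most \<open>3\<close>, which only the estimates for \<open>OH\<close> lose). If \<open>norm x = s\<close>
  and \<open>k\<close> is about \<open>t / s\<close>, where \<open>t\<close> is a distance that the amplifications do not collapse, then the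
  matrix with all entries \<open>f x - f 0\<close> has norm at least \<open>1\<close>, so \<open>norm (f x - f 0)\<close> is at least a
  constant times \<open>s\<close>. Now let columns of \<open>n\<close> orthonormal vectors in \<open>X\<close> have norms of order \<open>n powr \<alpha>\<close>, and
  let the lower exponent in \<open>Y\<close> be \<open>\<beta> > \<alpha>\<close>. With \<open>s = n powr (- \<alpha>)\<close>, the column of the
  vectors \<open>s * e i\<close> stays at bounded distance from \<open>0\<close>, whereas its image is at a distance of at least
  a constant times \<open>n powr (\<beta> - \<alpha>)\<close> from the image of \<open>0\<close>. This is impossible for large \<open>n\<close>
  (\<open>no_embedding_of_line_growth\<close>). For every ordered pair of distinct spaces from the list, \<open>\<alpha> < \<beta>\<close>
  holds for the columns or for the rows.

  The exponents in \<open>OH\<close> come from complex interpolation. An upper bound follows from an explicit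
  analytic function through the given matrix (\<open>interp_norm_le\<close>). A lower bound is dual: a functional of norm
  at most \<open>M0\<close> for the row norm and at most \<open>M1\<close> for the column norm has norm at most \<open>sqrt (M0 * M1)\<close> for
  the interpolated norm (\<open>functional_le_interp_norm\<close>), by the three lines theorem
  (\<open>three_lines_midpoint\<close>). The pairing with the conjugate of the matrix under consideration is a functional
  for which this is sharp enough.
\<close>
section \<open>The three lines theorem at the midpoint\<close>

text \<open>A boundary bound propagates to an unbounded strip because the function is bounded:
  multiplication by a Gaussian, which decays along the strip and can be made arbitrarily close to \<open>1\<close>,
  reduces the claim to the maximum modulus principle on a rectangle.\<close>

lemma phragmen_lindelof_strip:
  assumes cont: "continuous_on strip h" and hol: "h holomorphic_on interior strip"
    and bdd: "\<And>z. z \<in> strip \<Longrightarrow> cmod (h z) \<le> B"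
    and left: "\<And>t. cmod (h (Complex 0 t)) \<le> 1" and right: "\<And>t. cmod (h (Complex 1 t)) \<le> 1"
    and z: "z \<in> strip"
  shows "cmod (h z) \<le> 1"
proof -
  have damped: "cmod (h z * exp (of_real e * (z\<^sup>2 - 1))) \<le> 1" if "e > 0" for e
  proof -
    \<comment> \<open>The summand \<open>- 1\<close> keeps the Gaussian factor at most \<open>1\<close> on the whole strip.\<close>
    define k where "k w = h w * exp (of_real e * (w\<^sup>2 - 1))" for w
    have cmod_k: "cmod (k w) = cmod (h w) * exp (e * ((Re w)\<^sup>2 - (Im w)\<^sup>2 - 1))" for w
      by (simp add: k_def norm_mult power2_eq_square)
    have gauss: "exp (e * ((Re w)\<^sup>2 - (Im w)\<^sup>2 - 1)) \<le> exp (- e * (Im w)\<^sup>2)" if "w \<in> strip" for w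
    proof -
      have "(Re w)\<^sup>2 \<le> 1" using that by (simp add: strip_def power_le_one)
      then have "e * ((Re w)\<^sup>2 - (Im w)\<^sup>2 - 1) \<le> e * (- (Im w)\<^sup>2)"
        using \<open>e > 0\<close> by (intro mult_left_mono) auto
      then show ?thesis by simp
    qed
    have "((\<lambda>y::real. B * exp (- e * y\<^sup>2)) \<longlongrightarrow> 0) at_top"
      using \<open>e > 0\<close> by real_asymp
    then have "eventually (\<lambda>y. B * exp (- e * y\<^sup>2) < 1 \<and> \<bar>Im z\<bar> < y) at_top"
      by (intro eventually_conj order_tendstoD(2)[where y = 0] eventually_gt_at_top) auto
    from eventually_happens[OF this] obtain y
      where y: "B * exp (- e * y\<^sup>2) < 1" "\<bar>Im z\<bar> < y"
      by auto
    \<comment> \<open>A rectangle so high that the global bound \<open>B\<close>, once damped, is below \<open>1\<close> on its horizontal sides.\<close>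
    define Q where "Q = cbox (Complex 0 (- y)) (Complex 1 y)"
    have Q: "w \<in> Q \<longleftrightarrow> 0 \<le> Re w \<and> Re w \<le> 1 \<and> - y \<le> Im w \<and> Im w \<le> y" for w
      by (auto simp: Q_def in_cbox_complex_iff)
    have sub: "Q \<subseteq> strip" by (auto simp: Q strip_def)
    have intQ: "w \<in> interior Q \<longleftrightarrow> 0 < Re w \<and> Re w < 1 \<and> - y < Im w \<and> Im w < y" for w
      by (auto simp: Q_def interior_cbox in_box_complex_iff)
    have "cmod (k z) \<le> 1"
    proof (rule maximum_modulus_frontier[of k Q])
      show "k holomorphic_on interior Q"
        unfolding k_def
        by (intro holomorphic_intros holomorphic_on_subset[OF hol] interior_mono sub)
      show "continuous_on (closure Q) k"
        unfolding k_def using sub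
        by (intro continuous_intros continuous_on_subset[OF cont])
          (simp add: Q_def closure_closed closed_cbox)
      show "bounded Q" by (simp add: Q_def)
      show "z \<in> Q" using z y(2) by (auto simp: Q strip_def)
      fix w assume w: "w \<in> frontier Q"
      then have wQ: "w \<in> Q"
        using frontier_subset_closed[of Q] by (auto simp: Q_def)
      then have ws: "w \<in> strip" using sub by auto
      have "w \<notin> interior Q" using w by (simp add: frontier_def)
      then consider "Re w = 0" | "Re w = 1" | "\<bar>Im w\<bar> = y"
        using wQ unfolding intQ Q by linarith
      then show "cmod (k w) \<le> 1"
      proof cases
        case 1
        then have "cmod (h w) \<le> 1" using left[of "Im w"] by (metis complex_surj)
        moreover have "exp (- e * (Im w)\<^sup>2) \<le> 1" using \<open>e > 0\<close> by simp
        ultimately show ?thesis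
          unfolding cmod_k using gauss[OF ws] by (intro mult_le_one) auto
      next
        case 2
        then have "cmod (h w) \<le> 1" using right[of "Im w"] by (metis complex_surj)
        moreover have "exp (- e * (Im w)\<^sup>2) \<le> 1" using \<open>e > 0\<close> by simp
        ultimately show ?thesis
          unfolding cmod_k using gauss[OF ws] by (intro mult_le_one) auto
      next
        case 3
        have "(Im w)\<^sup>2 = y\<^sup>2" by (metis 3 power2_abs)
        moreover have "B \<ge> 0" using bdd[OF z] norm_ge_zero order_trans by blast
        ultimately have "cmod (k w) \<le> B * exp (- e * y\<^sup>2)"
          unfolding cmod_k using gauss[OF ws] bdd[OF ws] by (intro mult_mono) auto
        then show ?thesis using y(1) by simp
      qed
    qed
    then show ?thesis by (simp add: k_def)
  qed
  have "((\<lambda>e. cmod (h z * exp (of_real e * (z\<^sup>2 - 1)))) \<longlongrightarrow>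
      cmod (h z * exp (of_real 0 * (z\<^sup>2 - 1)))) (at_right (0::real))"
    by (intro tendsto_intros)
  then have "((\<lambda>e. cmod (h z * exp (of_real e * (z\<^sup>2 - 1)))) \<longlongrightarrow> cmod (h z)) (at_right (0::real))"
    by simp
  then show ?thesis
    by (rule tendsto_upperbound)
      (auto simp: eventually_at_right_less intro!: eventually_mono[OF eventually_at_right_less] damped)
qed

text \<open>Hadamard's three lines theorem at the point \<open>1/2\<close>. Dividing by the zero-free function
  \<open>M0 powr (1 - z) * M1 powr z\<close> makes both boundary bounds equal to \<open>1\<close>.\<close>

lemma three_lines_midpoint:
  assumes cont: "continuous_on strip g" and hol: "g holomorphic_on interior strip"
    and bdd: "\<And>z. z \<in> strip \<Longrightarrow> cmod (g z) \<le> B"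
    and left: "\<And>t. cmod (g (Complex 0 t)) \<le> M0" and right: "\<And>t. cmod (g (Complex 1 t)) \<le> M1"
    and pos: "M0 > 0" "M1 > 0"
  shows "cmod (g (1 / 2)) \<le> sqrt (M0 * M1)"
proof -
  define w where "w z = exp (- ((1 - z) * of_real (ln M0) + z * of_real (ln M1)))" for z :: complex
  have cmod_w: "cmod (w z) = exp (- ((1 - Re z) * ln M0 + Re z * ln M1))" for z
    by (simp add: w_def)
  have cmod_w_le: "cmod (w z) \<le> exp (\<bar>ln M0\<bar> + \<bar>ln M1\<bar>)" if "z \<in> strip" for z
  proof -
    have z: "0 \<le> Re z" "Re z \<le> 1" using that by (auto simp: strip_def)
    have "\<bar>(1 - Re z) * ln M0\<bar> \<le> 1 * \<bar>ln M0\<bar>" "\<bar>Re z * ln M1\<bar> \<le> 1 * \<bar>ln M1\<bar>"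
      using z unfolding abs_mult by (intro mult_right_mono; simp)+
    then show ?thesis unfolding cmod_w by simp
  qed
  have "cmod (g (1 / 2) * w (1 / 2)) \<le> 1"
  proof (rule phragmen_lindelof_strip[of "\<lambda>z. g z * w z"])
    show "continuous_on strip (\<lambda>z. g z * w z)"
      unfolding w_def by (intro continuous_intros cont)
    show "(\<lambda>z. g z * w z) holomorphic_on interior strip"
      unfolding w_def by (intro holomorphic_intros hol)
    show "cmod (g z * w z) \<le> B * exp (\<bar>ln M0\<bar> + \<bar>ln M1\<bar>)" if "z \<in> strip" for z
    proof -
      have "B \<ge> 0" using bdd[OF that] norm_ge_zero order_trans by blast
      then show ?thesis
        unfolding norm_mult using bdd[OF that] cmod_w_le[OF that] by (intro mult_mono) auto
    qed
    show "cmod (g (Complex 0 t) * w (Complex 0 t)) \<le> 1" for t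
      using left[of t] pos by (simp add: norm_mult cmod_w exp_minus field_simps)
    show "cmod (g (Complex 1 t) * w (Complex 1 t)) \<le> 1" for t
      using right[of t] pos by (simp add: norm_mult cmod_w exp_minus field_simps)
    show "1 / 2 \<in> strip" by (simp add: strip_def)
  qed
  moreover have "cmod (w (1 / 2)) = 1 / sqrt (M0 * M1)"
  proof -
    have "ln (sqrt (M0 * M1)) = ln M0 / 2 + ln M1 / 2"
      using pos by (simp add: ln_sqrt ln_mult add_divide_distrib)
    then have "exp (ln M0 / 2 + ln M1 / 2) = sqrt (M0 * M1)"
      using pos by (metis exp_ln mult_pos_pos real_sqrt_gt_zero)
    moreover have "cmod (w (1 / 2)) = inverse (exp (ln M0 / 2 + ln M1 / 2))"
      by (simp only: cmod_w exp_minus) simp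
    ultimately show ?thesis by (simp add: inverse_eq_divide)
  qed
  ultimately show ?thesis using pos by (simp add: norm_mult divide_le_eq)
qed

section \<open>Seminorms and functionals on the midpoint interpolation space\<close>

text \<open>Homogeneity is asked for as an inequality only; the converse inequality follows by applying it
  to the inverse scalar.\<close>

definition cseminorm :: "('v::complex_vector \<Rightarrow> real) \<Rightarrow> bool" where
  "cseminorm N \<longleftrightarrow> (\<forall>x. N x \<ge> 0) \<and> (\<forall>x y. N (x + y) \<le> N x + N y) \<and>
     (\<forall>c x. N (c *\<^sub>C x) \<le> cmod c * N x)"

lemma cseminormD:
  assumes "cseminorm N"
  shows "N x \<ge> 0" "N (x + y) \<le> N x + N y" "N (c *\<^sub>C x) \<le> cmod c * N x" "N 0 = 0"
proof -
  show "N x \<ge> 0" "N (x + y) \<le> N x + N y" "N (c *\<^sub>C x) \<le> cmod c * N x" for x y c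
    using assms by (auto simp: cseminorm_def)
  from this(1)[of 0] this(3)[of 0 0] show "N 0 = 0" by simp
qed

lemma sum_space_self:
  assumes "complex_vector.subspace V"
  shows "sum_space V V = V"
proof
  show "sum_space V V \<subseteq> V"
    using complex_vector.subspace_add[OF assms] by (auto simp: sum_space_def)
  show "V \<subseteq> sum_space V V"
  proof
    fix x assume "x \<in> V"
    then show "x \<in> sum_space V V"
      unfolding sum_space_def using complex_vector.subspace_0[OF assms]
      by (intro CollectI exI[of _ x] exI[of _ 0]) simp
  qed
qed

context
  fixes V :: "'v::complex_vector set" and N0 N1 :: "'v \<Rightarrow> real"
  assumes V: "complex_vector.subspace V" and N0: "cseminorm N0" and N1: "cseminorm N1"
begin

lemma sum_norm_nonneg: "x \<in> V \<Longrightarrow> sum_norm V N0 V N1 x \<ge> 0"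
  and sum_norm_le_left_norm: "x \<in> V \<Longrightarrow> sum_norm V N0 V N1 x \<le> N0 x"
proof -
  assume x: "x \<in> V"
  let ?S = "{N0 a + N1 b | a b. a \<in> V \<and> b \<in> V \<and> x = a + b}"
  have nonneg: "r \<ge> 0" if "r \<in> ?S" for r
    using that cseminormD(1)[OF N0] cseminormD(1)[OF N1] by auto
  have mem: "N0 x \<in> ?S"
    using x complex_vector.subspace_0[OF V] cseminormD(4)[OF N1]
    by (intro CollectI exI[of _ x] exI[of _ 0]) simp
  show "sum_norm V N0 V N1 x \<ge> 0"
    unfolding sum_norm_def using mem nonneg by (intro cInf_greatest) blast+
  show "sum_norm V N0 V N1 x \<le> N0 x"
    unfolding sum_norm_def using mem nonneg by (intro cInf_lower bdd_belowI[of _ 0])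
qed

text \<open>The sum norm is the largest seminorm below both \<open>N0\<close> and \<open>N1\<close>, so a functional bounded by each of
  them is bounded by it. This turns continuity and analyticity of vector-valued functions, which are
  defined by the sum norm, into the same properties of scalar functions.\<close>

lemma functional_le_sum_norm:
  fixes L :: "'v \<Rightarrow> complex"
  assumes add: "\<And>x y. L (x + y) = L x + L y"
    and le: "\<And>x. x \<in> V \<Longrightarrow> cmod (L x) \<le> K * N0 x" "\<And>x. x \<in> V \<Longrightarrow> cmod (L x) \<le> K * N1 x"
    and K: "K > 0" and x: "x \<in> V"
  shows "cmod (L x) \<le> K * sum_norm V N0 V N1 x"
proof -
  let ?S = "{N0 a + N1 b | a b. a \<in> V \<and> b \<in> V \<and> x = a + b}"
  have "N0 x + N1 0 \<in> ?S" using x complex_vector.subspace_0[OF V]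
    by (intro CollectI exI[of _ x] exI[of _ 0]) simp
  moreover have "cmod (L x) / K \<le> r" if "r \<in> ?S" for r
  proof -
    from that obtain a b where ab: "a \<in> V" "b \<in> V" "x = a + b" "r = N0 a + N1 b" by blast
    have "cmod (L x) \<le> cmod (L a) + cmod (L b)" by (simp add: ab add norm_triangle_ineq)
    also have "\<dots> \<le> K * r" using le(1)[OF ab(1)] le(2)[OF ab(2)] by (simp add: ab distrib_left)
    finally show ?thesis using K by (simp add: divide_le_eq mult.commute)
  qed
  ultimately have "cmod (L x) / K \<le> sum_norm V N0 V N1 x"
    unfolding sum_norm_def by (intro cInf_greatest) blast+
  then show ?thesis using K by (simp add: divide_le_eq mult.commute)
qed

text \<open>Boundedness of the boundary values is what makes the suprema in \<open>calderon_norm\<close> meaningful.\<close>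

lemma bdd_above_vanishing:
  fixes g :: "real \<Rightarrow> 'v"
  assumes N: "cseminorm N"
    and cont: "\<And>t. ((\<lambda>u. N (g u - g t)) \<longlongrightarrow> 0) (at t)"
    and lim: "((\<lambda>t. N (g t)) \<longlongrightarrow> 0) at_infinity"
  shows "bdd_above (range (\<lambda>t. N (g t)))"
proof -
  \<comment> \<open>The reverse triangle inequality makes \<open>\<lambda>t. N (g t)\<close> continuous.\<close>
  have diff: "\<bar>N a - N b\<bar> \<le> N (a - b)" for a b
  proof -
    have "N (b - a) \<le> N (a - b)"
      using cseminormD(3)[OF N, of "-1" "a - b"] complex_vector.scale_minus_left[of 1 "a - b"]
      by (simp add: scaleC_one)
    then show ?thesis
      using cseminormD(2)[OF N, of "a - b" b] cseminormD(2)[OF N, of "b - a" a] by simp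
  qed
  have "((\<lambda>u. N (g u)) \<longlongrightarrow> N (g t)) (at t)" for t
  proof (rule LIM_zero_cancel, rule Lim_null_comparison[OF _ cont[of t]])
    show "\<forall>\<^sub>F u in at t. norm (N (g u) - N (g t)) \<le> N (g u - g t)" using diff by simp
  qed
  then have co: "continuous_on UNIV (\<lambda>t. N (g t))" by (simp add: continuous_on_def)
  have "\<forall>\<^sub>F t in at_infinity. N (g t) < 1" by (rule order_tendstoD(2)[OF lim]) simp
  then obtain b where b: "\<And>t. \<bar>t\<bar> \<ge> b \<Longrightarrow> N (g t) < 1"
    by (auto simp: eventually_at_infinity)
  have "compact ((\<lambda>t. N (g t)) ` {- b..b})"
    by (intro compact_continuous_image continuous_on_subset[OF co]) auto
  then obtain B where B: "\<And>t. t \<in> {- b..b} \<Longrightarrow> N (g t) \<le> B"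
    using compact_imp_bounded bounded_imp_bdd_above unfolding bdd_above_def by (metis imageI)
  show ?thesis
  proof (rule bdd_aboveI2)
    fix t
    have "t \<in> {- b..b}" if "\<not> b \<le> \<bar>t\<bar>" using that by auto
    then show "N (g t) \<le> max 1 B" using b[of t] B[of t] by fastforce
  qed
qed

lemma calderon_norm_upper:
  assumes f: "f \<in> calderon_space V N0 V N1"
  shows "N0 (f (Complex 0 t)) \<le> calderon_norm N0 N1 f" "N1 (f (Complex 1 t)) \<le> calderon_norm N0 N1 f"
proof -
  have bdd: "bdd_above (range (\<lambda>t. N0 (f (Complex 0 t))))" "bdd_above (range (\<lambda>t. N1 (f (Complex 1 t))))"
    using f by (auto intro!: bdd_above_vanishing N0 N1 simp: calderon_space_def)
  from cSUP_upper[OF UNIV_I bdd(1), of t] cSUP_upper[OF UNIV_I bdd(2), of t]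
  show "N0 (f (Complex 0 t)) \<le> calderon_norm N0 N1 f" "N1 (f (Complex 1 t)) \<le> calderon_norm N0 N1 f"
    unfolding calderon_norm_def by linarith+
qed

lemma calderon_norm_nonneg:
  assumes "f \<in> calderon_space V N0 V N1"
  shows "calderon_norm N0 N1 f \<ge> 0"
  using cseminormD(1)[OF N0] calderon_norm_upper(1)[OF assms] by (rule order_trans)

text \<open>The scalar function \<open>\<lambda>z. L (f z)\<close> satisfies the hypotheses of the three lines theorem, with
  boundary bounds \<open>M0\<close> and \<open>M1\<close> times the norm of \<open>f\<close>.\<close>

lemma functional_le_calderon_norm:
  fixes L :: "'v \<Rightarrow> complex"
  assumes add: "\<And>x y. L (x + y) = L x + L y" and scaleC: "\<And>c x. L (c *\<^sub>C x) = c * L x"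
    and le0: "\<And>x. x \<in> V \<Longrightarrow> cmod (L x) \<le> M0 * N0 x" and le1: "\<And>x. x \<in> V \<Longrightarrow> cmod (L x) \<le> M1 * N1 x"
    and pos: "M0 > 0" "M1 > 0" and f: "f \<in> calderon_space V N0 V N1"
  shows "cmod (L (f (1 / 2))) \<le> sqrt (M0 * M1) * calderon_norm N0 N1 f"
proof -
  define K where "K = max M0 M1"
  note ss = sum_space_self[OF V]
  let ?S = "sum_norm V N0 V N1"
  have K: "cmod (L x) \<le> K * ?S x" if "x \<in> V" for x
  proof (rule functional_le_sum_norm[OF add _ _ _ that])
    fix y assume y: "y \<in> V"
    have "M0 * N0 y \<le> K * N0 y" "M1 * N1 y \<le> K * N1 y"
      using cseminormD(1)[OF N0] cseminormD(1)[OF N1] by (auto simp: K_def intro: mult_right_mono)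
    then show "cmod (L y) \<le> K * N0 y" "cmod (L y) \<le> K * N1 y" using le0[OF y] le1[OF y] by linarith+
  qed (use pos in \<open>simp add: K_def\<close>)
  have Ldiff: "L (x - y) = L x - L y" for x y using add[of "x - y" y] by simp
  have fV: "f z \<in> V" if "z \<in> strip" for z using f that by (simp add: calderon_space_def ss)
  obtain B where B: "\<And>z. z \<in> strip \<Longrightarrow> ?S (f z) \<le> B" using f by (auto simp: calderon_space_def)
  have cont: "continuous_on strip (\<lambda>z. L (f z))"
    unfolding continuous_on_def
  proof
    fix z assume z: "z \<in> strip"
    have "((\<lambda>w. K * ?S (f w - f z)) \<longlongrightarrow> K * 0) (at z within strip)"
      using f z by (intro tendsto_intros) (simp add: calderon_space_def)
    then have lim: "((\<lambda>w. K * ?S (f w - f z)) \<longlongrightarrow> 0) (at z within strip)" by simp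
    show "((\<lambda>w. L (f w)) \<longlongrightarrow> L (f z)) (at z within strip)"
    proof (rule LIM_zero_cancel, rule Lim_null_comparison[OF _ lim])
      show "\<forall>\<^sub>F w in at z within strip. norm (L (f w) - L (f z)) \<le> K * ?S (f w - f z)"
        unfolding Ldiff[symmetric]
        by (rule eventually_at_filter[THEN iffD2], rule always_eventually)
          (auto intro!: K complex_vector.subspace_diff[OF V] fV z)
    qed
  qed
  have hol: "(\<lambda>z. L (f z)) holomorphic_on interior strip"
    unfolding holomorphic_on_open[OF open_interior]
  proof (intro ballI)
    fix z assume z: "z \<in> interior strip"
    then obtain D where D: "D \<in> V"
      and lim: "((\<lambda>w. ?S (inverse (w - z) *\<^sub>C (f w - f z) - D)) \<longlongrightarrow> 0) (at z)"
      using f unfolding calderon_space_def ss by blast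
    have lim: "((\<lambda>w. K * ?S (inverse (w - z) *\<^sub>C (f w - f z) - D)) \<longlongrightarrow> 0) (at z)"
      using tendsto_mult_left[OF lim, of K] by simp
    have zs: "z \<in> strip" using z interior_subset by blast
    have "((\<lambda>w. (L (f w) - L (f z)) / (w - z)) \<longlongrightarrow> L D) (at z)"
    proof (rule LIM_zero_cancel, rule Lim_null_comparison[OF _ lim])
      have "\<forall>\<^sub>F w in at z. w \<in> interior strip" by (rule eventually_at_in_open'[OF open_interior z])
      then show "\<forall>\<^sub>F w in at z. norm ((L (f w) - L (f z)) / (w - z) - L D)
          \<le> K * ?S (inverse (w - z) *\<^sub>C (f w - f z) - D)"
      proof eventually_elim
        case (elim w)
        then have ws: "w \<in> strip" using interior_subset by blast
        have "(L (f w) - L (f z)) / (w - z) - L D = L (inverse (w - z) *\<^sub>C (f w - f z) - D)"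
          by (simp add: Ldiff scaleC divide_inverse mult.commute)
        then show ?case
          using K[OF complex_vector.subspace_diff[OF V complex_vector.subspace_scale[OF V
                  complex_vector.subspace_diff[OF V fV[OF ws] fV[OF zs]]] D]] by simp
      qed
    qed
    then show "\<exists>D. ((\<lambda>z. L (f z)) has_field_derivative D) (at z)"
      by (auto simp: has_field_derivative_iff)
  qed
  have Kpos: "K > 0" using pos by (simp add: K_def)
  have bdd: "cmod (L (f z)) \<le> K * B" if "z \<in> strip" for z
    using K[OF fV[OF that]] B[OF that] Kpos by (meson mult_left_mono less_imp_le order_trans)
  let ?c = "calderon_norm N0 N1 f"
  have Vb: "f (Complex 0 t) \<in> V" "f (Complex 1 t) \<in> V" for t by (auto intro!: fV simp: strip_def)
  \<comment> \<open>The three lines theorem needs positive bounds, but the norm of \<open>f\<close> may be \<open>0\<close>; hence the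
    summand \<open>e\<close>.\<close>
  have "cmod (L (f (1 / 2))) \<le> sqrt (M0 * M1) * (?c + e)" if "e > 0" for e
  proof -
    have le: "cmod (L (f (Complex 0 t))) \<le> M0 * (?c + e)" "cmod (L (f (Complex 1 t))) \<le> M1 * (?c + e)" for t
    proof -
      have "N0 (f (Complex 0 t)) \<le> ?c + e" "N1 (f (Complex 1 t)) \<le> ?c + e"
        using calderon_norm_upper[OF f, of t] that by linarith+
      then have "M0 * N0 (f (Complex 0 t)) \<le> M0 * (?c + e)" "M1 * N1 (f (Complex 1 t)) \<le> M1 * (?c + e)"
        using pos by (auto intro: mult_left_mono)
      then show "cmod (L (f (Complex 0 t))) \<le> M0 * (?c + e)" "cmod (L (f (Complex 1 t))) \<le> M1 * (?c + e)"
        using le0[OF Vb(1)[of t]] le1[OF Vb(2)[of t]] by linarith+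
    qed
    have cpos: "?c + e > 0" using calderon_norm_nonneg[OF f] that by simp
    have "cmod (L (f (1 / 2))) \<le> sqrt ((M0 * (?c + e)) * (M1 * (?c + e)))"
      by (rule three_lines_midpoint[OF cont hol bdd le]) (use pos cpos in simp_all)
    also have "\<dots> = sqrt ((M0 * M1) * (?c + e)\<^sup>2)" by (simp add: power2_eq_square mult_ac)
    also have "\<dots> = sqrt (M0 * M1) * (?c + e)" using cpos by (simp add: real_sqrt_mult)
    finally show ?thesis .
  qed
  moreover have "((\<lambda>e. sqrt (M0 * M1) * (?c + e)) \<longlongrightarrow> sqrt (M0 * M1) * (?c + 0)) (at_right 0)"
    by (intro tendsto_intros)
  ultimately show ?thesis
    by (intro tendsto_lowerbound[where F = "at_right (0::real)" and f = "\<lambda>e. sqrt (M0 * M1) * (?c + e)"])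
      (auto intro!: eventually_mono[OF eventually_at_right_less])
qed

text \<open>Scalar multiples of one fixed vector suffice to realise every interpolated vector with a good norm,
  so only scalar functions \<open>\<phi>\<close> need to be examined.\<close>

lemma scaled_in_calderon_space:
  assumes a: "a \<in> V" and cont: "continuous_on strip \<phi>" and hol: "\<phi> holomorphic_on interior strip"
    and bdd: "\<And>z. z \<in> strip \<Longrightarrow> cmod (\<phi> z) \<le> B"
    and lim0: "((\<lambda>t. \<phi> (Complex 0 t)) \<longlongrightarrow> 0) at_infinity"
    and lim1: "((\<lambda>t. \<phi> (Complex 1 t)) \<longlongrightarrow> 0) at_infinity"
  shows "(\<lambda>z. \<phi> z *\<^sub>C a) \<in> calderon_space V N0 V N1"
proof -
  let ?S = "sum_norm V N0 V N1"
  have scV: "c *\<^sub>C a \<in> V" for c by (rule complex_vector.subspace_scale[OF V a])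
  have S: "?S (c *\<^sub>C a) \<le> cmod c * N0 a" "?S (c *\<^sub>C a) \<ge> 0" for c
    using sum_norm_le_left_norm[OF scV] sum_norm_nonneg[OF scV] cseminormD(3)[OF N0] order_trans by blast+
  have diff: "c *\<^sub>C a - d *\<^sub>C a = (c - d) *\<^sub>C a" for c d
    by (simp add: complex_vector.scale_left_diff_distrib)
  have S0: "((\<lambda>x. ?S (g x *\<^sub>C a)) \<longlongrightarrow> 0) F" if "(g \<longlongrightarrow> 0) F" for g :: "complex \<Rightarrow> complex" and F
    using tendsto_mult_right[OF tendsto_norm[OF that], of "N0 a"] S
    by (intro Lim_null_comparison[where f = "\<lambda>x. ?S (g x *\<^sub>C a)" and g = "\<lambda>x. cmod (g x) * N0 a"]) auto
  have N0lim: "((\<lambda>x. N (g x *\<^sub>C a)) \<longlongrightarrow> 0) F" if "(g \<longlongrightarrow> 0) F" "cseminorm N" for N and g :: "real \<Rightarrow> complex" and F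
    using tendsto_mult_right[OF tendsto_norm[OF that(1)], of "N a"] cseminormD(1,3)[OF that(2)]
    by (intro Lim_null_comparison[where f = "\<lambda>x. N (g x *\<^sub>C a)" and g = "\<lambda>x. cmod (g x) * N a"]) auto
  have line: "((\<lambda>u. \<phi> (Complex r u) - \<phi> (Complex r t)) \<longlongrightarrow> 0) (at t)" if "0 \<le> r" "r \<le> 1" for r t
  proof -
    have "continuous_on UNIV (\<lambda>u. \<phi> (Complex r u))"
      by (rule continuous_on_compose2[OF cont])
        (use that in \<open>auto simp: strip_def Complex_eq intro!: continuous_intros\<close>)
    then have "((\<lambda>u. \<phi> (Complex r u)) \<longlongrightarrow> \<phi> (Complex r t)) (at t)"
      by (simp add: continuous_on_def)
    then show ?thesis by (rule LIM_zero)
  qed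
  show ?thesis
    unfolding calderon_space_def sum_space_self[OF V]
  proof (intro CollectI conjI ballI allI)
    show "\<phi> z *\<^sub>C a \<in> V" for z by (rule scV)
    show "\<exists>K. \<forall>z\<in>strip. ?S (\<phi> z *\<^sub>C a) \<le> K"
      using S(1) mult_right_mono[OF bdd cseminormD(1)[OF N0]] order_trans by blast
    show "((\<lambda>w. ?S (\<phi> w *\<^sub>C a - \<phi> z *\<^sub>C a)) \<longlongrightarrow> 0) (at z within strip)" if "z \<in> strip" for z
      unfolding diff using cont that by (intro S0 LIM_zero) (simp add: continuous_on_def)
    show "\<exists>D\<in>V. ((\<lambda>w. ?S (inverse (w - z) *\<^sub>C (\<phi> w *\<^sub>C a - \<phi> z *\<^sub>C a) - D)) \<longlongrightarrow> 0) (at z)"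
      if z: "z \<in> interior strip" for z
    proof -
      obtain d where "(\<phi> has_field_derivative d) (at z)"
        using hol z by (auto simp: holomorphic_on_open)
      then have "((\<lambda>w. (\<phi> w - \<phi> z) / (w - z)) \<longlongrightarrow> d) (at z)"
        by (simp add: has_field_derivative_iff)
      then have "((\<lambda>w. ?S (((\<phi> w - \<phi> z) / (w - z) - d) *\<^sub>C a)) \<longlongrightarrow> 0) (at z)"
        by (intro S0 LIM_zero)
      then have "((\<lambda>w. ?S (inverse (w - z) *\<^sub>C (\<phi> w *\<^sub>C a - \<phi> z *\<^sub>C a) - d *\<^sub>C a)) \<longlongrightarrow> 0) (at z)"
        by (simp add: diff scaleC_scaleC divide_inverse mult.commute)
      then show ?thesis using scV by blast
    qed
    show "((\<lambda>u. N0 (\<phi> (Complex 0 u) *\<^sub>C a - \<phi> (Complex 0 t) *\<^sub>C a)) \<longlongrightarrow> 0) (at t)"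
      "((\<lambda>u. N1 (\<phi> (Complex 1 u) *\<^sub>C a - \<phi> (Complex 1 t) *\<^sub>C a)) \<longlongrightarrow> 0) (at t)" for t
      unfolding diff by (intro N0lim line N0 N1; simp)+
    show "((\<lambda>t. N0 (\<phi> (Complex 0 t) *\<^sub>C a)) \<longlongrightarrow> 0) at_infinity"
      "((\<lambda>t. N1 (\<phi> (Complex 1 t) *\<^sub>C a)) \<longlongrightarrow> 0) at_infinity"
      by (intro N0lim lim0 lim1 N0 N1)+
  qed (rule scV)+
qed

text \<open>The function \<open>(m0 / m1) powr (z - 1/2)\<close> times \<open>a\<close> has norm at most \<open>sqrt (m0 * m1)\<close> on both
  boundary lines. The Gaussian factor, equal to \<open>1\<close> at the midpoint, supplies the decay at infinity and
  costs a factor of at most \<open>exp (3/4)\<close>.\<close>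

lemma geometric_mean_witness:
  assumes a: "a \<in> V" and le: "N0 a \<le> m0" "N1 a \<le> m1" and pos: "m0 > 0" "m1 > 0"
  obtains f where "f \<in> calderon_space V N0 V N1" "f (1 / 2) = a"
    "calderon_norm N0 N1 f \<le> 3 * sqrt (m0 * m1)"
proof -
  \<comment> \<open>\<open>\<phi> z = (m0 / m1) powr (z - 1/2)\<close> times the Gaussian.\<close>
  define \<alpha> where "\<alpha> = ln m0 - ln m1"
  define \<phi> where "\<phi> z = exp (z\<^sup>2 - 1 / 4 + (z - 1 / 2) * of_real \<alpha>)" for z :: complex
  have cmod: "cmod (\<phi> (Complex x t)) = exp (x\<^sup>2 - t\<^sup>2 - 1 / 4 + (x - 1 / 2) * \<alpha>)" for x t
    by (simp add: \<phi>_def power2_eq_square)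
  have vanish: "((\<lambda>t. \<phi> (Complex x t)) \<longlongrightarrow> 0) at_infinity" for x
  proof (rule tendsto_norm_zero_cancel)
    have "((\<lambda>t::real. exp (x\<^sup>2 - t\<^sup>2 - 1 / 4 + (x - 1 / 2) * \<alpha>)) \<longlongrightarrow> 0) at_top"
      "((\<lambda>t::real. exp (x\<^sup>2 - t\<^sup>2 - 1 / 4 + (x - 1 / 2) * \<alpha>)) \<longlongrightarrow> 0) at_bot"
      by real_asymp+
    then show "((\<lambda>t. cmod (\<phi> (Complex x t))) \<longlongrightarrow> 0) at_infinity"
      unfolding cmod at_infinity_eq_at_top_bot by (rule filterlim_sup)
  qed
  define f where "f z = \<phi> z *\<^sub>C a" for z
  have "f \<in> calderon_space V N0 V N1"
    unfolding f_def
  proof (rule scaled_in_calderon_space[OF a])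
    show "continuous_on strip \<phi>" "\<phi> holomorphic_on interior strip"
      unfolding \<phi>_def by (intro continuous_intros holomorphic_intros; simp)+
    show "cmod (\<phi> z) \<le> exp (1 + \<bar>\<alpha>\<bar>)" if "z \<in> strip" for z
    proof -
      have z: "0 \<le> Re z" "Re z \<le> 1" using that by (auto simp: strip_def)
      have "\<bar>Re z - 1 / 2\<bar> * \<bar>\<alpha>\<bar> \<le> 1 * \<bar>\<alpha>\<bar>" using z by (intro mult_right_mono) auto
      then have "(Re z - 1 / 2) * \<alpha> \<le> \<bar>\<alpha>\<bar>" unfolding abs_mult[symmetric] by linarith
      moreover have "(Re z)\<^sup>2 \<le> 1" using z by (simp add: power_le_one)
      moreover have "(Im z)\<^sup>2 \<ge> 0" by simp
      ultimately have "(Re z)\<^sup>2 - (Im z)\<^sup>2 - 1 / 4 + (Re z - 1 / 2) * \<alpha> \<le> 1 + \<bar>\<alpha>\<bar>" by linarith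
      then show ?thesis using cmod[of "Re z" "Im z"] by simp
    qed
  qed (rule vanish)+
  moreover have "f (1 / 2) = a" by (simp add: f_def \<phi>_def power2_eq_square scaleC_one)
  moreover have "calderon_norm N0 N1 f \<le> 3 * sqrt (m0 * m1)"
  proof -
    have root: "sqrt (m0 * m1) = exp (ln m0 / 2 + ln m1 / 2)"
    proof -
      have "ln (sqrt (m0 * m1)) = ln m0 / 2 + ln m1 / 2"
        using pos by (simp add: ln_sqrt ln_mult add_divide_distrib)
      then show ?thesis using pos exp_ln[of "sqrt (m0 * m1)"] by simp
    qed
    have e: "exp x \<le> 3 * exp y" if "x \<le> 1 + y" for x y :: real
    proof -
      have "exp x \<le> exp (1 + y)" using that by simp
      also have "\<dots> \<le> 3 * exp y" unfolding exp_add by (intro mult_right_mono exp_le) simp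
      finally show ?thesis .
    qed
    have "N0 (f (Complex 0 t)) \<le> 3 * sqrt (m0 * m1)" for t
    proof -
      have "N0 (f (Complex 0 t)) \<le> cmod (\<phi> (Complex 0 t)) * m0"
        unfolding f_def using cseminormD(3)[OF N0] mult_left_mono[OF le(1)] norm_ge_zero order_trans by blast
      also have "\<dots> = exp (- t\<^sup>2 - 1 / 4 - \<alpha> / 2 + ln m0)"
        using pos by (simp add: cmod exp_add exp_diff)
      also have "\<dots> \<le> 3 * sqrt (m0 * m1)"
        unfolding root by (rule e) (simp add: \<alpha>_def field_simps)
      finally show ?thesis .
    qed
    moreover have "N1 (f (Complex 1 t)) \<le> 3 * sqrt (m0 * m1)" for t
    proof -
      have "N1 (f (Complex 1 t)) \<le> cmod (\<phi> (Complex 1 t)) * m1"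
        unfolding f_def using cseminormD(3)[OF N1] mult_left_mono[OF le(2)] norm_ge_zero order_trans by blast
      also have "\<dots> = exp (1 - t\<^sup>2 - 1 / 4 + \<alpha> / 2 + ln m1)"
        using pos by (simp add: cmod exp_add exp_diff)
      also have "\<dots> \<le> 3 * sqrt (m0 * m1)"
        unfolding root by (rule e) (simp add: \<alpha>_def field_simps)
      finally show ?thesis .
    qed
    ultimately show ?thesis unfolding calderon_norm_def by (simp add: cSUP_least)
  qed
  ultimately show ?thesis by (rule that)
qed

text \<open>A factor arbitrarily close to \<open>1\<close> in place of \<open>3\<close> would come from a flatter Gaussian; coarse estimates
  are insensitive to it.\<close>

lemma interp_norm_le:
  assumes "a \<in> V" "N0 a \<le> m0" "N1 a \<le> m1" "m0 > 0" "m1 > 0"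
  shows "interp_norm (1 / 2) V N0 V N1 a \<le> 3 * sqrt (m0 * m1)"
proof -
  obtain f where f: "f \<in> calderon_space V N0 V N1" "f (1 / 2) = a"
    "calderon_norm N0 N1 f \<le> 3 * sqrt (m0 * m1)"
    using geometric_mean_witness[OF assms] .
  have "interp_norm (1 / 2) V N0 V N1 a \<le> calderon_norm N0 N1 f"
    unfolding interp_norm_def using f(1,2) calderon_norm_nonneg
    by (intro cInf_lower bdd_belowI[of _ 0]) auto
  with f(3) show ?thesis by simp
qed

lemma interp_space_eq: "interp_space (1 / 2) V N0 V N1 = V"
proof
  show "interp_space (1 / 2) V N0 V N1 \<subseteq> V"
    by (auto simp: interp_space_def calderon_space_def sum_space_self[OF V] strip_def)
  show "V \<subseteq> interp_space (1 / 2) V N0 V N1"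
  proof
    fix a assume a: "a \<in> V"
    obtain f where "f \<in> calderon_space V N0 V N1" "f (1 / 2) = a"
      using geometric_mean_witness[OF a, of "N0 a + 1" "N1 a + 1"]
        cseminormD(1)[OF N0, of a] cseminormD(1)[OF N1, of a] by auto
    then show "a \<in> interp_space (1 / 2) V N0 V N1" by (auto simp: interp_space_def)
  qed
qed

lemma functional_le_interp_norm:
  fixes L :: "'v \<Rightarrow> complex"
  assumes add: "\<And>x y. L (x + y) = L x + L y" and scaleC: "\<And>c x. L (c *\<^sub>C x) = c * L x"
    and le: "\<And>x. x \<in> V \<Longrightarrow> cmod (L x) \<le> M0 * N0 x" "\<And>x. x \<in> V \<Longrightarrow> cmod (L x) \<le> M1 * N1 x"
    and pos: "M0 > 0" "M1 > 0" and a: "a \<in> V"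
  shows "cmod (L a) \<le> sqrt (M0 * M1) * interp_norm (1 / 2) V N0 V N1 a"
proof -
  have "cmod (L a) / sqrt (M0 * M1) \<le> interp_norm (1 / 2) V N0 V N1 a"
    unfolding interp_norm_def
  proof (rule cInf_greatest)
    have "a \<in> interp_space (1 / 2) V N0 V N1" using a by (simp add: interp_space_eq)
    then show "{calderon_norm N0 N1 f | f. f \<in> calderon_space V N0 V N1 \<and> f (of_real (1 / 2)) = a} \<noteq> {}"
      by (auto simp: interp_space_def)
    fix r assume "r \<in> {calderon_norm N0 N1 f | f. f \<in> calderon_space V N0 V N1 \<and> f (of_real (1 / 2)) = a}"
    then obtain f where "f \<in> calderon_space V N0 V N1" "f (1 / 2) = a" "r = calderon_norm N0 N1 f"
      by auto
    then show "cmod (L a) / sqrt (M0 * M1) \<le> r"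
      using functional_le_calderon_norm[OF add scaleC le pos, of f] pos
      by (simp add: divide_le_eq mult.commute)
  qed
  then show ?thesis using pos by (simp add: divide_le_eq mult.commute)
qed

end

section \<open>The row and the column space as copies of the sequence space\<close>

text \<open>The pairing is bilinear, not sesquilinear, because \<open>row_op a\<close> is the functional \<open>bidot a\<close>
  followed by the first unit vector.\<close>

definition bidot :: "ell2 \<Rightarrow> ell2 \<Rightarrow> complex" where
  "bidot a x = (\<Sum>j. coord a j * coord x j)"

lemma summable_bidot: "summable (\<lambda>j. coord a j * coord x j)"
  by (rule summable_norm_cancel[OF summable_coord_mult(1)])

lemma norm_bidot_le: "cmod (bidot a x) \<le> norm a * norm x"
  unfolding bidot_def
  by (rule order_trans[OF summable_norm[OF summable_coord_mult(1)] summable_coord_mult(2)])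

lemma bidot_add_left: "bidot (a + b) x = bidot a x + bidot b x"
  by (simp add: bidot_def plus_ell2.rep_eq ring_distribs suminf_add summable_bidot)

lemma bidot_scaleC_left: "bidot (c *\<^sub>C a) x = c * bidot a x"
  using suminf_mult[OF summable_bidot[of a x], of c]
  by (simp add: bidot_def scaleC_ell2.rep_eq mult.assoc)

lemma bidot_zero_left [simp]: "bidot 0 x = 0"
  by (simp add: bidot_def zero_ell2.rep_eq)

lemma bidot_sum_left: "bidot (sum a I) x = (\<Sum>i\<in>I. bidot (a i) x)"
  by (induction I rule: infinite_finite_induct) (simp_all add: bidot_add_left)

lemma bidot_unit_vec: "bidot (unit_vec j) x = coord x j"
proof -
  have "bidot (unit_vec j) x = (\<Sum>k\<in>{j}. coord (unit_vec j) k * coord x k)"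
    unfolding bidot_def by (rule suminf_finite) (auto simp: unit_vec.rep_eq)
  then show ?thesis by (simp add: unit_vec.rep_eq)
qed

definition conj_vec :: "ell2 \<Rightarrow> ell2" where
  "conj_vec a = Abs_ell2 (\<lambda>j. cnj (coord a j))"

lemma coord_conj_vec: "coord (conj_vec a) j = cnj (coord a j)"
  by (simp add: conj_vec_def Abs_ell2_inverse summable_coord)

lemma norm_conj_vec [simp]: "norm (conj_vec a) = norm a"
  by (rule power2_eq_imp_eq) (simp_all add: norm_ell2 coord_conj_vec)

lemma bidot_conj_vec: "bidot a (conj_vec a) = of_real ((norm a)\<^sup>2)"
proof -
  have "bidot a (conj_vec a) = (\<Sum>j. of_real ((cmod (coord a j))\<^sup>2))"
    by (simp add: bidot_def coord_conj_vec complex_norm_square[symmetric] del: of_real_power)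
  also have "\<dots> = of_real (\<Sum>j. (cmod (coord a j))\<^sup>2)"
    by (rule suminf_of_real[symmetric, OF summable_coord])
  finally show ?thesis by (simp add: norm_ell2)
qed

lemma norm_unit_vec [simp]: "norm (unit_vec i) = 1"
proof -
  have "(norm (unit_vec i))\<^sup>2 = (\<Sum>k\<in>{i}. (cmod (coord (unit_vec i) k))\<^sup>2)"
    unfolding norm_ell2 by (rule suminf_finite) (auto simp: unit_vec.rep_eq)
  then have "(norm (unit_vec i))\<^sup>2 = 1\<^sup>2" by (simp add: unit_vec.rep_eq)
  then show ?thesis by (rule power2_eq_imp_eq) simp_all
qed

lemma coord_sum: "coord (sum a I) k = (\<Sum>i\<in>I. coord (a i) k)"
  by (induction I rule: infinite_finite_induct)
    (simp_all add: zero_ell2.rep_eq plus_ell2.rep_eq)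

lemma bessel_unit_vec: "(\<Sum>i<n. (cmod (coord x i))\<^sup>2) \<le> (norm x)\<^sup>2"
  unfolding norm_ell2 by (rule sum_le_suminf[OF summable_coord]) auto

lemma norm_sum_unit_vec: "(norm (\<Sum>i<n. c i *\<^sub>C unit_vec i))\<^sup>2 = (\<Sum>i<n. (cmod (c i))\<^sup>2)"
proof -
  have co: "coord (\<Sum>i<n. c i *\<^sub>C unit_vec i) k = (if k < n then c k else 0)" for k
    by (simp add: coord_sum scaleC_ell2.rep_eq unit_vec.rep_eq if_distrib cong: if_cong)
  have "(norm (\<Sum>i<n. c i *\<^sub>C unit_vec i))\<^sup>2
      = (\<Sum>k\<in>{..<n}. (cmod (coord (\<Sum>i<n. c i *\<^sub>C unit_vec i) k))\<^sup>2)"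
    unfolding norm_ell2 by (rule suminf_finite) (auto simp: co)
  also have "\<dots> = (\<Sum>i<n. (cmod (c i))\<^sup>2)" by (rule sum.cong) (simp_all add: co)
  finally show ?thesis .
qed

lemma row_op_bidot: "blinfun_apply (row_op a) x = bidot a x *\<^sub>C unit_vec 0"
  by (simp add: row_op_apply bidot_def)

lemma row_op_add: "row_op (a + b) = row_op a + row_op b"
  by (rule blinfun_eqI) (simp add: row_op_bidot bidot_add_left plus_blinfun.rep_eq scaleC_add_left)

lemma row_op_scaleC: "row_op (c *\<^sub>C a) = c *\<^sub>C row_op a"
  by (rule blinfun_eqI) (simp add: row_op_bidot bidot_scaleC_left scaleC_blinfun.rep_eq scaleC_scaleC)

lemma column_op_add: "column_op (a + b) = column_op a + column_op b"
  by (rule blinfun_eqI) (simp add: column_op_apply plus_blinfun.rep_eq scaleC_add_right)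

lemma column_op_scaleC: "column_op (c *\<^sub>C a) = c *\<^sub>C column_op a"
  by (rule blinfun_eqI) (simp add: column_op_apply scaleC_blinfun.rep_eq scaleC_scaleC mult.commute)

lemma norm_row_op: "norm (row_op a) = norm a"
proof (rule antisym)
  show "norm (row_op a) \<le> norm a"
    by (rule norm_blinfun_bound) (simp_all add: row_op_bidot norm_scaleC norm_bidot_le)
  have "norm a * norm a = norm (blinfun_apply (row_op a) (conj_vec a))"
    by (simp add: row_op_bidot norm_scaleC bidot_conj_vec norm_power power2_eq_square norm_mult)
  also have "\<dots> \<le> norm (row_op a) * norm a"
    using norm_blinfun[of "row_op a" "conj_vec a"] by simp
  finally show "norm a \<le> norm (row_op a)"
    by (cases "a = 0") simp_all
qed

lemma norm_column_op: "norm (column_op a) = norm a"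
proof (rule antisym)
  have "norm (blinfun_apply (column_op a) x) \<le> norm a * norm x" for x
    using mult_right_mono[OF norm_coord_le[of x 0], of "norm a"]
    by (simp add: column_op_apply norm_scaleC mult.commute)
  then show "norm (column_op a) \<le> norm a"
    by (intro norm_blinfun_bound) simp_all
  show "norm a \<le> norm (column_op a)"
    using norm_blinfun[of "column_op a" "unit_vec 0"]
    by (simp add: column_op_apply unit_vec.rep_eq scaleC_one)
qed

text \<open>The range of a linear isometry on a complete space is closed, so it contains the closed span of
  any subset of it.\<close>

lemma closure_cspan_eq_range:
  fixes \<iota> :: "ell2 \<Rightarrow> ell2 \<Rightarrow>\<^sub>L ell2"
  assumes add: "\<And>a b. \<iota> (a + b) = \<iota> a + \<iota> b"
    and scaleC: "\<And>c a. \<iota> (c *\<^sub>C a) = c *\<^sub>C \<iota> a"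
    and isometry: "\<And>a. norm (\<iota> a) = norm a"
    and range: "range \<iota> \<subseteq> closure (cspan S)" and S: "S \<subseteq> range \<iota>"
  shows "closure (cspan S) = range \<iota>"
proof
  have bl: "bounded_linear \<iota>"
    by (rule bounded_linear_intro[where K = 1]) (simp_all add: add scaleC scaleR_scaleC isometry)
  have "complete (range \<iota>)"
    by (rule complete_isometric_image[where e = 1])
      (simp_all add: isometry complete_UNIV bl)
  then have "closed (range \<iota>)" by (rule complete_imp_closed)
  moreover have "complex_vector.subspace (range \<iota>)"
  proof (rule complex_vector.subspaceI)
    show "0 \<in> range \<iota>"
      using linear_0[OF bounded_linear.linear[OF bl]] by (intro range_eqI) (rule sym)
    show "x + y \<in> range \<iota>" if "x \<in> range \<iota>" "y \<in> range \<iota>" for x y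
      using that add[symmetric] by fastforce
    show "c *\<^sub>C x \<in> range \<iota>" if "x \<in> range \<iota>" for c x
      using that scaleC[symmetric] by fastforce
  qed
  then have "cspan S \<subseteq> range \<iota>" by (rule complex_vector.span_minimal[OF S])
  ultimately show "closure (cspan S) \<subseteq> range \<iota>" by (intro closure_minimal)
qed (rule range)

lemma row_space_eq: "row_space = range row_op"
  unfolding row_space_def
proof (rule closure_cspan_eq_range)
  show "range row_op \<subseteq> closure (cspan (range (mat_unit 0)))"
    using row_op_in_row_space by (auto simp: row_space_def)
  have "mat_unit 0 j = row_op (unit_vec j)" for j
    by (rule blinfun_eqI) (simp add: mat_unit.rep_eq row_op_bidot bidot_unit_vec)
  then show "range (mat_unit 0) \<subseteq> range row_op" by auto
qed (simp_all add: row_op_add row_op_scaleC norm_row_op)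

lemma column_space_eq: "column_space = range column_op"
  unfolding column_space_def
proof (rule closure_cspan_eq_range)
  show "range column_op \<subseteq> closure (cspan (range (\<lambda>j. mat_unit j 0)))"
    using column_op_in_column_space by (auto simp: column_space_def)
  have "mat_unit j 0 = column_op (unit_vec j)" for j
    by (rule blinfun_eqI) (simp add: mat_unit.rep_eq column_op_apply)
  then show "range (\<lambda>j. mat_unit j 0) \<subseteq> range column_op" by auto
qed (simp_all add: column_op_add column_op_scaleC norm_column_op)

section \<open>Matrices of operators\<close>

lemma sum_mult_le_L2_set:
  "(\<Sum>i\<in>I. norm (f i) * norm (g i)) \<le> L2_set (\<lambda>i. norm (f i)) I * L2_set (\<lambda>i. norm (g i)) I"
  using L2_set_mult_ineq[of "\<lambda>i. norm (f i)" "\<lambda>i. norm (g i)" I] by simp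

definition frobenius :: "nat \<Rightarrow> 'a::real_normed_vector mat \<Rightarrow> real" where
  "frobenius n A = L2_set (\<lambda>i. L2_set (\<lambda>j. norm (A i j)) {..<n}) {..<n}"

text \<open>The Hilbert-Schmidt norm dominates the operator norm, by the Cauchy-Schwarz inequality. It shows at the
  same time that the supremum in \<open>op_mat_norm\<close> is one of a bounded set.\<close>

lemma frobenius_apply:
  fixes A :: "('h::complex_hilbert_space \<Rightarrow>\<^sub>L 'h) mat"
  shows "L2_set (\<lambda>i. norm (\<Sum>j<n. blinfun_apply (A i j) (x j))) {..<n}
    \<le> frobenius n A * L2_set (\<lambda>j. norm (x j)) {..<n}"
proof -
  have "norm (\<Sum>j<n. blinfun_apply (A i j) (x j))
      \<le> L2_set (\<lambda>j. norm (A i j)) {..<n} * L2_set (\<lambda>j. norm (x j)) {..<n}" for i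
  proof -
    have "norm (\<Sum>j<n. blinfun_apply (A i j) (x j)) \<le> (\<Sum>j<n. norm (A i j) * norm (x j))"
      by (rule sum_norm_le) (rule norm_blinfun)
    then show ?thesis using sum_mult_le_L2_set by (rule order_trans)
  qed
  then show ?thesis
    unfolding frobenius_def by (subst L2_set_left_distrib) (auto intro!: L2_set_mono)
qed

lemma op_mat_norm_L2:
  "op_mat_norm n A = (SUP x\<in>{x. L2_set (\<lambda>j. norm (x j)) {..<n} \<le> 1}.
     L2_set (\<lambda>i. norm (\<Sum>j<n. blinfun_apply (A i j) (x j))) {..<n})"
  unfolding op_mat_norm_def L2_set_def by simp

lemma L2_set_norm_scaleR:
  fixes x :: "'i \<Rightarrow> 'a::real_normed_vector"
  shows "L2_set (\<lambda>i. norm (r *\<^sub>R x i)) I = \<bar>r\<bar> * L2_set (\<lambda>i. norm (x i)) I"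
  by (simp add: L2_set_right_distrib)

lemma op_mat_norm_le:
  assumes "c \<ge> 0"
    and "\<And>x. L2_set (\<lambda>i. norm (\<Sum>j<n. blinfun_apply (A i j) (x j))) {..<n}
      \<le> c * L2_set (\<lambda>j. norm (x j)) {..<n}"
  shows "op_mat_norm n A \<le> c"
  unfolding op_mat_norm_L2
proof (rule cSUP_least)
  have "(\<lambda>j. 0) \<in> {x :: nat \<Rightarrow> 'a. L2_set (\<lambda>j. norm (x j)) {..<n} \<le> 1}"
    by (simp add: L2_set_0')
  then show "{x :: nat \<Rightarrow> 'a. L2_set (\<lambda>j. norm (x j)) {..<n} \<le> 1} \<noteq> {}"
    by (rule ex_in_conv[THEN iffD1, OF exI])
  fix x :: "nat \<Rightarrow> 'a" assume "x \<in> {x. L2_set (\<lambda>j. norm (x j)) {..<n} \<le> 1}"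
  then have "c * L2_set (\<lambda>j. norm (x j)) {..<n} \<le> c * 1"
    using assms(1) by (intro mult_left_mono) auto
  with assms(2)[of x] show "L2_set (\<lambda>i. norm (\<Sum>j<n. blinfun_apply (A i j) (x j))) {..<n} \<le> c"
    by linarith
qed

lemma bdd_above_op_mat_norm:
  fixes A :: "('h::complex_hilbert_space \<Rightarrow>\<^sub>L 'h) mat"
  shows "bdd_above ((\<lambda>x. L2_set (\<lambda>i. norm (\<Sum>j<n. blinfun_apply (A i j) (x j))) {..<n}) `
     {x :: nat \<Rightarrow> 'h. L2_set (\<lambda>j. norm (x j)) {..<n} \<le> 1})"
proof (rule bdd_aboveI2)
  fix x :: "nat \<Rightarrow> 'h" assume "x \<in> {x. L2_set (\<lambda>j. norm (x j)) {..<n} \<le> 1}"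
  then have "frobenius n A * L2_set (\<lambda>j. norm (x j)) {..<n} \<le> frobenius n A * 1"
    by (intro mult_left_mono) (auto simp: frobenius_def)
  with frobenius_apply[of A x n]
  show "L2_set (\<lambda>i. norm (\<Sum>j<n. blinfun_apply (A i j) (x j))) {..<n} \<le> frobenius n A"
    by linarith
qed

lemma op_mat_norm_nonneg: "op_mat_norm n (A :: ('h::complex_hilbert_space \<Rightarrow>\<^sub>L 'h) mat) \<ge> 0"
proof -
  have "L2_set (\<lambda>i. norm (\<Sum>j<n. blinfun_apply (A i j) ((\<lambda>_. 0 :: 'h) j))) {..<n} \<le> op_mat_norm n A"
    unfolding op_mat_norm_L2 by (intro cSUP_upper bdd_above_op_mat_norm) (simp add: L2_set_0')
  then show ?thesis using L2_set_nonneg order_trans by blast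
qed

lemma op_mat_norm_apply:
  fixes x :: "nat \<Rightarrow> 'h::complex_hilbert_space"
  shows "L2_set (\<lambda>i. norm (\<Sum>j<n. blinfun_apply (A i j) (x j))) {..<n}
    \<le> op_mat_norm n A * L2_set (\<lambda>j. norm (x j)) {..<n}"
proof -
  let ?out = "\<lambda>x. L2_set (\<lambda>i. norm (\<Sum>j<n. blinfun_apply (A i j) (x j))) {..<n}"
  let ?in = "\<lambda>x :: nat \<Rightarrow> 'h. L2_set (\<lambda>j. norm (x j)) {..<n}"
  show ?thesis
  proof (cases "?in x = 0")
    case True
    with frobenius_apply[of A x n] show ?thesis by simp
  next
    case False
    define r where "r = inverse (?in x)"
    have pos: "?in x > 0" using False L2_set_nonneg[of "\<lambda>j. norm (x j)" "{..<n}"] by linarith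
    then have "?in (\<lambda>j. r *\<^sub>R x j) = 1"
      by (subst L2_set_norm_scaleR) (simp add: r_def)
    then have "?out (\<lambda>j. r *\<^sub>R x j) \<le> op_mat_norm n A"
      unfolding op_mat_norm_L2 by (intro cSUP_upper bdd_above_op_mat_norm) simp
    moreover have "?out (\<lambda>j. r *\<^sub>R x j) = r * ?out x"
    proof -
      have "?out (\<lambda>j. r *\<^sub>R x j) = L2_set (\<lambda>i. norm (r *\<^sub>R (\<Sum>j<n. blinfun_apply (A i j) (x j)))) {..<n}"
        by (simp only: blinfun.scaleR_right scaleR_sum_right)
      also have "\<dots> = \<bar>r\<bar> * ?out x" by (rule L2_set_norm_scaleR)
      finally show ?thesis using pos by (simp add: r_def)
    qed
    ultimately have "r * ?out x \<le> op_mat_norm n A" by simp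
    then show ?thesis using pos by (simp add: r_def field_simps)
  qed
qed

lemma op_mat_norm_le_frobenius: "op_mat_norm n A \<le> frobenius n A"
  by (intro op_mat_norm_le frobenius_apply) (simp add: frobenius_def)

lemma op_mat_norm_triangle: "op_mat_norm n (A + B) \<le> op_mat_norm n A + op_mat_norm n B"
proof (rule op_mat_norm_le)
  show "op_mat_norm n A + op_mat_norm n B \<ge> 0" by (simp add: op_mat_norm_nonneg)
  fix x :: "nat \<Rightarrow> 'a"
  let ?out = "\<lambda>A :: ('a \<Rightarrow>\<^sub>L 'a) mat. L2_set (\<lambda>i. norm (\<Sum>j<n. blinfun_apply (A i j) (x j))) {..<n}"
  have "?out (A + B) \<le> L2_set (\<lambda>i. norm (\<Sum>j<n. blinfun_apply (A i j) (x j))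
      + norm (\<Sum>j<n. blinfun_apply (B i j) (x j))) {..<n}"
    by (intro L2_set_mono) (simp_all add: plus_blinfun.rep_eq sum.distrib norm_triangle_ineq)
  also have "\<dots> \<le> ?out A + ?out B" by (rule L2_set_triangle_ineq)
  also have "\<dots> \<le> (op_mat_norm n A + op_mat_norm n B) * L2_set (\<lambda>j. norm (x j)) {..<n}"
    using op_mat_norm_apply[of A x n] op_mat_norm_apply[of B x n] by (simp add: distrib_right)
  finally show "?out (A + B) \<le> \<dots>" .
qed

lemma op_mat_norm_scaleC_le: "op_mat_norm n (c *\<^sub>C A) \<le> cmod c * op_mat_norm n A"
proof (rule op_mat_norm_le)
  show "cmod c * op_mat_norm n A \<ge> 0" by (simp add: op_mat_norm_nonneg)
  fix x :: "nat \<Rightarrow> 'a"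
  have "(\<Sum>j<n. c *\<^sub>C blinfun_apply (A i j) (x j)) = c *\<^sub>C (\<Sum>j<n. blinfun_apply (A i j) (x j))" for i
    by (rule complex_vector.scale_sum_right[symmetric])
  then have "L2_set (\<lambda>i. norm (\<Sum>j<n. blinfun_apply ((c *\<^sub>C A) i j) (x j))) {..<n}
      = cmod c * L2_set (\<lambda>i. norm (\<Sum>j<n. blinfun_apply (A i j) (x j))) {..<n}"
    by (simp add: scaleC_fun_def scaleC_blinfun.rep_eq norm_scaleC L2_set_right_distrib)
  also have "\<dots> \<le> cmod c * (op_mat_norm n A * L2_set (\<lambda>j. norm (x j)) {..<n})"
    by (intro mult_left_mono op_mat_norm_apply) simp
  finally show "L2_set (\<lambda>i. norm (\<Sum>j<n. blinfun_apply ((c *\<^sub>C A) i j) (x j))) {..<n}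
      \<le> cmod c * op_mat_norm n A * L2_set (\<lambda>j. norm (x j)) {..<n}" by (simp add: mult.assoc)
qed

section \<open>Blocks, rows and columns in the row and column norms\<close>

definition block :: "nat \<Rightarrow> 'a::zero \<Rightarrow> 'a mat" where
  "block k a = (\<lambda>i j. if i < k \<and> j < k then a else 0)"

datatype line = Row | Column

definition line_mat :: "line \<Rightarrow> nat \<Rightarrow> (nat \<Rightarrow> 'a::zero) \<Rightarrow> 'a mat" where
  "line_mat l n y = (\<lambda>i j. case l of
     Row \<Rightarrow> if i = 0 \<and> j < n then y j else 0
   | Column \<Rightarrow> if j = 0 \<and> i < n then y i else 0)"

definition line_entry :: "line \<Rightarrow> 'a mat \<Rightarrow> nat \<Rightarrow> 'a" where
  "line_entry l A i = (case l of Row \<Rightarrow> A 0 i | Column \<Rightarrow> A i 0)"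

definition row_norm :: "nat \<Rightarrow> ell2 mat \<Rightarrow> real" where
  "row_norm n A = op_mat_norm n (\<lambda>i j. row_op (A i j))"

definition column_norm :: "nat \<Rightarrow> ell2 mat \<Rightarrow> real" where
  "column_norm n A = op_mat_norm n (\<lambda>i j. column_op (A i j))"

lemma row_op_zero [simp]: "row_op 0 = 0"
  and column_op_zero [simp]: "column_op 0 = 0"
  using row_op_add[of 0 0] column_op_add[of 0 0] by simp_all

lemma cseminorm_row_norm: "cseminorm (row_norm n)"
  unfolding cseminorm_def
proof (intro conjI allI)
  fix A B :: "ell2 mat" and c
  show "row_norm n A \<ge> 0" by (simp add: row_norm_def op_mat_norm_nonneg)
  show "row_norm n (A + B) \<le> row_norm n A + row_norm n B"
    using op_mat_norm_triangle[of n "\<lambda>i j. row_op (A i j)" "\<lambda>i j. row_op (B i j)"]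
    by (simp add: row_norm_def row_op_add plus_fun_def)
  show "row_norm n (c *\<^sub>C A) \<le> cmod c * row_norm n A"
    using op_mat_norm_scaleC_le[of n c "\<lambda>i j. row_op (A i j)"]
    by (simp add: row_norm_def row_op_scaleC scaleC_fun_def)
qed

lemma cseminorm_column_norm: "cseminorm (column_norm n)"
  unfolding cseminorm_def
proof (intro conjI allI)
  fix A B :: "ell2 mat" and c
  show "column_norm n A \<ge> 0" by (simp add: column_norm_def op_mat_norm_nonneg)
  show "column_norm n (A + B) \<le> column_norm n A + column_norm n B"
    using op_mat_norm_triangle[of n "\<lambda>i j. column_op (A i j)" "\<lambda>i j. column_op (B i j)"]
    by (simp add: column_norm_def column_op_add plus_fun_def)
  show "column_norm n (c *\<^sub>C A) \<le> cmod c * column_norm n A"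
    using op_mat_norm_scaleC_le[of n c "\<lambda>i j. column_op (A i j)"]
    by (simp add: column_norm_def column_op_scaleC scaleC_fun_def)
qed

lemma frobenius_eq: "frobenius n A = sqrt (\<Sum>i<n. \<Sum>j<n. (norm (A i j))\<^sup>2)"
  by (simp add: frobenius_def L2_set_def sum_nonneg)

lemma row_norm_le_frobenius: "row_norm n A \<le> frobenius n A"
  and column_norm_le_frobenius: "column_norm n A \<le> frobenius n A"
  using op_mat_norm_le_frobenius[of n "\<lambda>i j. row_op (A i j)"]
    op_mat_norm_le_frobenius[of n "\<lambda>i j. column_op (A i j)"]
  by (simp_all add: row_norm_def column_norm_def frobenius_def norm_row_op norm_column_op)

lemma frobenius_block:
  assumes "k \<le> n"
  shows "frobenius n (block k a) = k * norm a"
proof -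
  have row: "(\<Sum>j<n. (norm (block k a i j))\<^sup>2) = (if i < k then k * (norm a)\<^sup>2 else 0)" for i
  proof -
    have "(\<Sum>j<n. (norm (block k a i j))\<^sup>2) = (\<Sum>j<k. (norm (block k a i j))\<^sup>2)"
      using assms by (intro sum.mono_neutral_right) (auto simp: block_def)
    then show ?thesis by (simp add: block_def)
  qed
  have "(\<Sum>i<n. if i < k then k * (norm a)\<^sup>2 else 0) = (\<Sum>i<k. if i < k then k * (norm a)\<^sup>2 else 0)"
    using assms by (intro sum.mono_neutral_right) auto
  also have "\<dots> = (k * norm a)\<^sup>2" by (simp add: power2_eq_square)
  finally show ?thesis by (simp add: frobenius_eq row)
qed

lemma frobenius_line_mat:
  assumes "n \<ge> 1"
  shows "frobenius n (line_mat l n y) = L2_set (\<lambda>i. norm (y i)) {..<n}"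
proof (cases l)
  case Row
  have "(\<Sum>i<n. \<Sum>j<n. (norm (line_mat l n y i j))\<^sup>2)
      = (\<Sum>i<n. if i = 0 then \<Sum>j<n. (norm (y j))\<^sup>2 else 0)"
    by (intro sum.cong) (auto simp: line_mat_def Row)
  also have "\<dots> = (\<Sum>j<n. (norm (y j))\<^sup>2)" using assms by simp
  finally show ?thesis by (simp add: frobenius_eq L2_set_def)
next
  case Column
  have "(\<Sum>i<n. \<Sum>j<n. (norm (line_mat l n y i j))\<^sup>2)
      = (\<Sum>i<n. \<Sum>j<n. if j = 0 then (norm (y i))\<^sup>2 else 0)"
    by (intro sum.cong) (auto simp: line_mat_def Column)
  also have "\<dots> = (\<Sum>i<n. (norm (y i))\<^sup>2)" using assms by simp
  finally show ?thesis by (simp add: frobenius_eq L2_set_def)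
qed

lemma L2_set_norm_initial_constant:
  fixes k n :: nat and x :: "'a::real_normed_vector"
  assumes "k \<le> n"
  shows "L2_set (\<lambda>j. norm (if j < k then x else 0)) {..<n} = sqrt k * norm x"
proof -
  have "(\<Sum>j<n. (norm (if j < k then x else 0))\<^sup>2) = (\<Sum>j<k. (norm (if j < k then x else 0))\<^sup>2)"
    using assms by (intro sum.mono_neutral_right) auto
  then show ?thesis by (simp add: L2_set_def real_sqrt_mult)
qed

lemma sum_norm_le_L2_set:
  fixes k n :: nat
  assumes "k \<le> n"
  shows "(\<Sum>i<k. norm (v i)) \<le> sqrt k * L2_set (\<lambda>i. norm (v i)) {..<n}"
proof -
  have "(\<Sum>i<k. norm (1::real) * norm (v i)) \<le> L2_set (\<lambda>i. norm (1::real)) {..<k} * L2_set (\<lambda>i. norm (v i)) {..<k}"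
    by (rule sum_mult_le_L2_set)
  also have "\<dots> = sqrt k * L2_set (\<lambda>i. norm (v i)) {..<k}" by (simp add: L2_set_constant)
  also have "\<dots> \<le> sqrt k * L2_set (\<lambda>i. norm (v i)) {..<n}"
    unfolding L2_set_def using assms
    by (intro mult_left_mono real_sqrt_le_mono sum_mono2) auto
  finally show ?thesis by simp
qed

text \<open>The matrix is applied to a vector whose only nonzero component is the \<open>j\<close>-th.\<close>

lemma op_mat_norm_entry:
  fixes A :: "('h::complex_hilbert_space \<Rightarrow>\<^sub>L 'h) mat"
  assumes "i < n" "j < n"
  shows "norm (A i j) \<le> op_mat_norm n A"
proof (rule norm_blinfun_bound[OF op_mat_norm_nonneg])
  fix x :: 'h
  let ?x = "\<lambda>m. if m = j then x else 0"
  have ap: "(\<Sum>m<n. blinfun_apply (A l m) (?x m)) = blinfun_apply (A l j) x" for l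
    using assms by (simp add: if_distrib[of "blinfun_apply _"] cong: if_cong)
  have "norm (blinfun_apply (A i j) x) \<le> L2_set (\<lambda>l. norm (blinfun_apply (A l j) x)) {..<n}"
    using assms member_le_L2_set[of "{..<n}" i "\<lambda>l. norm (blinfun_apply (A l j) x)"] by simp
  also have "\<dots> \<le> op_mat_norm n A * L2_set (\<lambda>m. norm (?x m)) {..<n}"
    using op_mat_norm_apply[of A ?x n] unfolding ap .
  also have "L2_set (\<lambda>m. norm (?x m)) {..<n} = norm x"
    using assms by (simp add: L2_set_def if_distrib[of norm] if_distrib[of "\<lambda>r. r\<^sup>2"] cong: if_cong)
  finally show "norm (blinfun_apply (A i j) x) \<le> op_mat_norm n A * norm x" .
qed

lemma norm_line_entry_le:
  assumes "i < n"
  shows "norm (line_entry l A i) \<le> row_norm n A" "norm (line_entry l A i) \<le> column_norm n A"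
  using assms op_mat_norm_entry[of _ n _ "\<lambda>i j. row_op (A i j)"]
    op_mat_norm_entry[of _ n _ "\<lambda>i j. column_op (A i j)"]
  by (auto simp: line_entry_def row_norm_def column_norm_def norm_row_op norm_column_op split: line.split)

section \<open>Dual bounds\<close>

text \<open>Functionals on matrices of vectors that are used to bound matrix norms from below: they pair the
  first row or column with a given family, and the upper left \<open>k \<times> k\<close> block with copies of one vector.\<close>

definition line_pairing :: "line \<Rightarrow> nat \<Rightarrow> (nat \<Rightarrow> ell2) \<Rightarrow> ell2 mat \<Rightarrow> complex" where
  "line_pairing l n y A = (\<Sum>i<n. bidot (line_entry l A i) (y i))"

definition block_pairing :: "nat \<Rightarrow> ell2 \<Rightarrow> ell2 mat \<Rightarrow> complex" where
  "block_pairing k x A = (\<Sum>i<k. \<Sum>j<k. bidot (A i j) x)"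

lemma line_pairing_add: "line_pairing l n y (A + B) = line_pairing l n y A + line_pairing l n y B"
  and line_pairing_scaleC: "line_pairing l n y (c *\<^sub>C A) = c * line_pairing l n y A"
  by (cases l; simp add: line_pairing_def line_entry_def scaleC_fun_def bidot_add_left sum.distrib
      bidot_scaleC_left sum_distrib_left)+

lemma block_pairing_add: "block_pairing k x (A + B) = block_pairing k x A + block_pairing k x B"
  and block_pairing_scaleC: "block_pairing k x (c *\<^sub>C A) = c * block_pairing k x A"
  by (simp_all add: block_pairing_def scaleC_fun_def bidot_add_left sum.distrib
      bidot_scaleC_left sum_distrib_left)

lemma line_pairing_le_L2_set:
  "cmod (line_pairing l n y A)
    \<le> L2_set (\<lambda>i. norm (line_entry l A i)) {..<n} * L2_set (\<lambda>i. norm (y i)) {..<n}"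
proof -
  have "cmod (line_pairing l n y A) \<le> (\<Sum>i<n. norm (line_entry l A i) * norm (y i))"
    unfolding line_pairing_def by (rule sum_norm_le) (rule norm_bidot_le)
  then show ?thesis using sum_mult_le_L2_set by (rule order_trans)
qed

lemma line_pairing_le_bounded:
  assumes "\<And>i. i < n \<Longrightarrow> norm (line_entry l A i) \<le> N"
  shows "cmod (line_pairing l n y A) \<le> sqrt n * L2_set (\<lambda>i. norm (y i)) {..<n} * N"
proof (cases "n = 0")
  case True
  then show ?thesis by (simp add: line_pairing_def)
next
  case False
  then have N: "N \<ge> 0" using assms[of 0] norm_ge_zero order_trans by blast
  have "L2_set (\<lambda>i. norm (line_entry l A i)) {..<n} \<le> L2_set (\<lambda>i. N) {..<n}"
    by (rule L2_set_mono) (auto intro: assms)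
  also have "\<dots> = sqrt n * N" using N by (simp add: L2_set_constant)
  finally show ?thesis
    using line_pairing_le_L2_set[of l n y A]
      mult_right_mono[of _ "sqrt n * N" "L2_set (\<lambda>i. norm (y i)) {..<n}"] L2_set_nonneg
    by (fastforce simp: mult_ac)
qed

text \<open>Rows are cheap in the row norm: the pairing is a component of the image of \<open>y\<close> under the operator matrix.
  For columns only the bound on the individual entries is available, and it loses the factor \<open>sqrt n\<close>.\<close>

lemma line_pairing_le_row_norm:
  "cmod (line_pairing l n y A)
    \<le> (case l of Row \<Rightarrow> 1 | Column \<Rightarrow> sqrt n) * L2_set (\<lambda>i. norm (y i)) {..<n} * row_norm n A"
proof (cases l)
  case Column
  then show ?thesis using line_pairing_le_bounded[OF norm_line_entry_le(1)] by simp
next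
  case Row
  show ?thesis
  proof (cases "n = 0")
    case False
    let ?f = "\<lambda>i. norm (\<Sum>j<n. blinfun_apply (row_op (A i j)) (y j))"
    have "(\<Sum>j<n. blinfun_apply (row_op (A 0 j)) (y j)) = line_pairing l n y A *\<^sub>C unit_vec 0"
      by (simp add: row_op_bidot line_pairing_def line_entry_def Row complex_vector.scale_sum_left)
    then have "cmod (line_pairing l n y A) = ?f 0" by (simp add: norm_scaleC)
    also have "\<dots> \<le> L2_set ?f {..<n}" using False by (intro member_le_L2_set) auto
    also have "\<dots> \<le> row_norm n A * L2_set (\<lambda>i. norm (y i)) {..<n}"
      unfolding row_norm_def by (rule op_mat_norm_apply)
    finally show ?thesis by (simp add: Row mult.commute)
  qed (simp add: line_pairing_def)
qed

text \<open>For columns the factor is \<open>1\<close>, since the norm of a column is the square root of the sum of its squared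
  entry norms; for rows the bound by the individual entries loses \<open>sqrt n\<close>.\<close>

lemma line_pairing_le_column_norm:
  "cmod (line_pairing l n y A)
    \<le> (case l of Row \<Rightarrow> sqrt n | Column \<Rightarrow> 1) * L2_set (\<lambda>i. norm (y i)) {..<n} * column_norm n A"
proof (cases l)
  case Row
  then show ?thesis using line_pairing_le_bounded[OF norm_line_entry_le(2)] by simp
next
  case Column
  show ?thesis
  proof (cases "n = 0")
    case False
    \<comment> \<open>An operator \<open>column_op a\<close> maps \<open>unit_vec 0\<close> to \<open>a\<close>, so the vector with first component
      \<open>unit_vec 0\<close> and all others \<open>0\<close> recovers the first column of \<open>A\<close>.\<close>
    let ?e = "\<lambda>j::nat. if j < 1 then unit_vec 0 else 0"
    have "(\<Sum>j<n. blinfun_apply (column_op (A i j)) (?e j)) = line_entry l A i" for i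
    proof -
      have "(\<Sum>j<n. blinfun_apply (column_op (A i j)) (?e j))
          = (\<Sum>j\<in>{0}. blinfun_apply (column_op (A i j)) (?e j))"
        using False by (intro sum.mono_neutral_right) auto
      then show ?thesis
        by (simp add: Column line_entry_def column_op_apply unit_vec.rep_eq scaleC_one)
    qed
    then have "L2_set (\<lambda>i. norm (line_entry l A i)) {..<n}
        \<le> column_norm n A * L2_set (\<lambda>j. norm (?e j)) {..<n}"
      using op_mat_norm_apply[of "\<lambda>i j. column_op (A i j)" ?e n] by (simp add: column_norm_def)
    also have "L2_set (\<lambda>j. norm (?e j)) {..<n} = 1"
      using False L2_set_norm_initial_constant[of 1 n "unit_vec 0"] by (simp only:) simp
    finally have "L2_set (\<lambda>i. norm (line_entry l A i)) {..<n} \<le> column_norm n A" by simp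
    from mult_right_mono[OF this, of "L2_set (\<lambda>i. norm (y i)) {..<n}"]
    show ?thesis using line_pairing_le_L2_set[of l n y A] by (simp add: Column mult.commute)
  qed (simp add: line_pairing_def)
qed

text \<open>The block is applied to \<open>k\<close> copies of \<open>x\<close>, whose joint norm is \<open>sqrt k * norm x\<close>; summing the \<open>k\<close> components
  of the image costs another \<open>sqrt k\<close>.\<close>

lemma block_pairing_le_row_norm:
  assumes "k \<le> n"
  shows "cmod (block_pairing k x A) \<le> k * norm x * row_norm n A"
proof -
  let ?x = "\<lambda>j. if j < k then x else 0"
  let ?v = "\<lambda>i. \<Sum>j<n. blinfun_apply (row_op (A i j)) (?x j)"
  have v: "?v i = (\<Sum>j<k. bidot (A i j) x) *\<^sub>C unit_vec 0" for i
  proof -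
    have "?v i = (\<Sum>j<k. blinfun_apply (row_op (A i j)) (?x j))"
      using assms by (intro sum.mono_neutral_right) auto
    then show ?thesis by (simp add: row_op_bidot complex_vector.scale_sum_left)
  qed
  have "cmod (block_pairing k x A) \<le> (\<Sum>i<k. norm (?v i))"
    unfolding block_pairing_def by (rule sum_norm_le) (simp only: v norm_scaleC norm_unit_vec mult_1_right order_refl)
  also have "\<dots> \<le> sqrt k * L2_set (\<lambda>i. norm (?v i)) {..<n}"
    by (rule sum_norm_le_L2_set[OF assms])
  also have "\<dots> \<le> sqrt k * (row_norm n A * L2_set (\<lambda>j. norm (?x j)) {..<n})"
    unfolding row_norm_def by (intro mult_left_mono op_mat_norm_apply) simp
  also have "\<dots> = k * norm x * row_norm n A"
    unfolding L2_set_norm_initial_constant[OF assms] by (simp add: mult_ac)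
  finally show ?thesis .
qed

text \<open>As for the row norm, with \<open>k\<close> copies of \<open>unit_vec 0\<close> as test vector, which produce the row sums of the
  block.\<close>

lemma block_pairing_le_column_norm:
  assumes "k \<le> n"
  shows "cmod (block_pairing k x A) \<le> k * norm x * column_norm n A"
proof -
  let ?x = "\<lambda>j. if j < k then unit_vec 0 else 0"
  let ?v = "\<lambda>i. \<Sum>j<n. blinfun_apply (column_op (A i j)) (?x j)"
  have v: "?v i = (\<Sum>j<k. A i j)" for i
  proof -
    have "?v i = (\<Sum>j<k. blinfun_apply (column_op (A i j)) (?x j))"
      using assms by (intro sum.mono_neutral_right) auto
    then show ?thesis by (simp add: column_op_apply unit_vec.rep_eq scaleC_one)
  qed
  have "cmod (block_pairing k x A) \<le> (\<Sum>i<k. norm (?v i) * norm x)"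
    unfolding block_pairing_def
  proof (rule sum_norm_le)
    show "cmod (\<Sum>j<k. bidot (A i j) x) \<le> norm (?v i) * norm x" for i
      unfolding bidot_sum_left[symmetric] v by (rule norm_bidot_le)
  qed
  also have "\<dots> = norm x * (\<Sum>i<k. norm (?v i))"
    unfolding sum_distrib_left by (simp add: mult.commute)
  also have "\<dots> \<le> norm x * (sqrt k * L2_set (\<lambda>i. norm (?v i)) {..<n})"
    by (intro mult_left_mono sum_norm_le_L2_set[OF assms]) simp
  also have "\<dots> \<le> norm x * (sqrt k * (column_norm n A * L2_set (\<lambda>j. norm (?x j)) {..<n}))"
    unfolding column_norm_def by (intro mult_left_mono op_mat_norm_apply) simp_all
  also have "\<dots> = k * norm x * column_norm n A"
    unfolding L2_set_norm_initial_constant[OF assms] by (simp add: mult_ac)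
  finally show ?thesis .
qed

text \<open>The operator \<open>row_op (unit_vec i)\<close> reads off the \<open>i\<close>-th coordinate, so a column of these operators
  lists coordinates of a single vector, and Bessel's inequality applies.\<close>

lemma row_norm_column_le:
  assumes "s \<ge> 0"
  shows "row_norm n (line_mat Column n (\<lambda>i. s *\<^sub>R unit_vec i)) \<le> s"
  unfolding row_norm_def
proof (rule op_mat_norm_le[OF assms])
  fix x :: "nat \<Rightarrow> ell2"
  let ?A = "\<lambda>i j. row_op (line_mat Column n (\<lambda>i. s *\<^sub>R unit_vec i) i j)"
  show "L2_set (\<lambda>i. norm (\<Sum>j<n. blinfun_apply (?A i j) (x j))) {..<n} \<le> s * L2_set (\<lambda>j. norm (x j)) {..<n}"
  proof (cases "n = 0")
    case False
    have "norm (\<Sum>j<n. blinfun_apply (?A i j) (x j)) = s * cmod (coord (x 0) i)" if "i < n" for i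
    proof -
      have "(\<Sum>j<n. blinfun_apply (?A i j) (x j)) = (\<Sum>j\<in>{0}. blinfun_apply (?A i j) (x j))"
        using False by (intro sum.mono_neutral_right) (auto simp: line_mat_def)
      then show ?thesis
        using that assms by (simp add: line_mat_def row_op_bidot scaleR_scaleC bidot_scaleC_left
            bidot_unit_vec norm_scaleC norm_mult)
    qed
    then have "L2_set (\<lambda>i. norm (\<Sum>j<n. blinfun_apply (?A i j) (x j))) {..<n}
        = s * L2_set (\<lambda>i. cmod (coord (x 0) i)) {..<n}"
      using assms by (simp add: L2_set_right_distrib cong: L2_set_cong_simp)
    also have "\<dots> \<le> s * norm (x 0)"
      unfolding L2_set_def using assms
      by (intro mult_left_mono real_le_lsqrt bessel_unit_vec) simp_all
    also have "\<dots> \<le> s * L2_set (\<lambda>j. norm (x j)) {..<n}"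
      using assms False member_le_L2_set[of "{..<n}" 0 "\<lambda>j. norm (x j)"]
      by (intro mult_left_mono) auto
    finally show ?thesis .
  qed simp
qed

text \<open>The operators \<open>column_op (unit_vec j)\<close> have orthogonal ranges, and each of them reads a single coordinate
  of its argument.\<close>

lemma column_norm_row_le:
  assumes "s \<ge> 0"
  shows "column_norm n (line_mat Row n (\<lambda>i. s *\<^sub>R unit_vec i)) \<le> s"
  unfolding column_norm_def
proof (rule op_mat_norm_le[OF assms])
  fix x :: "nat \<Rightarrow> ell2"
  let ?A = "\<lambda>i j. column_op (line_mat Row n (\<lambda>i. s *\<^sub>R unit_vec i) i j)"
  let ?v = "\<Sum>j<n. coord (x j) 0 *\<^sub>C unit_vec j"
  have out: "(\<Sum>j<n. blinfun_apply (?A i j) (x j)) = (if i = 0 then s *\<^sub>R ?v else 0)" for i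
    by (simp add: line_mat_def column_op_apply scaleR_scaleC scaleC_scaleC mult.commute
        complex_vector.scale_sum_right)
  have "norm ?v \<le> L2_set (\<lambda>j. norm (x j)) {..<n}"
    unfolding L2_set_def
  proof (rule real_le_rsqrt)
    show "(norm ?v)\<^sup>2 \<le> (\<Sum>j<n. (norm (x j))\<^sup>2)"
      unfolding norm_sum_unit_vec by (intro sum_mono power_mono norm_coord_le) simp
  qed
  from mult_left_mono[OF this assms]
  have "norm (s *\<^sub>R ?v) \<le> s * L2_set (\<lambda>j. norm (x j)) {..<n}" using assms by simp
  moreover have "L2_set (\<lambda>i. norm (\<Sum>j<n. blinfun_apply (?A i j) (x j))) {..<n} \<le> norm (s *\<^sub>R ?v)"
    unfolding out L2_set_def
    by (rule real_le_lsqrt) (auto simp: if_distrib[of norm] if_distrib[of "\<lambda>r. r\<^sup>2"] sum.delta cong: if_cong)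
  ultimately show "L2_set (\<lambda>i. norm (\<Sum>j<n. blinfun_apply (?A i j) (x j))) {..<n} \<le> s * L2_set (\<lambda>j. norm (x j)) {..<n}"
    by (rule order_trans[rotated])
qed

section \<open>Growth of rows and columns obstructs embeddings\<close>

text \<open>A copy of \<open>\<ell>\<^sub>2\<close>, embedded by \<open>\<iota>\<close>, in which a block of \<open>k\<close> by \<open>k\<close> equal entries is \<open>k\<close> times as large
  as the entry. The factor \<open>3\<close> leaves room for the constant in \<open>interp_norm_le\<close>, here and below.\<close>

definition hilbertian :: "'a::ab_group_add matrix_normed \<Rightarrow> (ell2 \<Rightarrow> 'a) \<Rightarrow> bool" where
  "hilbertian X \<iota> \<longleftrightarrow> vecs X = range \<iota> \<and> (\<forall>a b. \<iota> (a - b) = \<iota> a - \<iota> b) \<and>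
     (\<forall>n k a. 1 \<le> k \<and> k \<le> n \<longrightarrow>
        k * norm a \<le> mat_norm X n (block k (\<iota> a)) \<and>
        mat_norm X n (block k (\<iota> a)) \<le> 3 * (k * norm a))"

text \<open>The exponents \<open>\<alpha>\<close> and \<open>\<beta>\<close> measure how the norm of a row or column of \<open>n\<close> vectors grows with \<open>n\<close>: at
  most like \<open>n powr \<alpha>\<close> for some orthonormal vectors, and at least like \<open>n powr \<beta>\<close> for all vectors of
  norm at least \<open>1\<close>.\<close>

definition line_growth_le :: "line \<Rightarrow> 'a::ab_group_add matrix_normed \<Rightarrow> (ell2 \<Rightarrow> 'a) \<Rightarrow> real \<Rightarrow> bool" where
  "line_growth_le l X \<iota> \<alpha> \<longleftrightarrow> (\<forall>n\<ge>1. \<forall>s>0.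
     mat_norm X n (line_mat l n (\<lambda>i. \<iota> (s *\<^sub>R unit_vec i))) \<le> 3 * s * real n powr \<alpha>)"

definition line_growth_ge :: "line \<Rightarrow> 'a::ab_group_add matrix_normed \<Rightarrow> (ell2 \<Rightarrow> 'a) \<Rightarrow> real \<Rightarrow> bool" where
  "line_growth_ge l X \<iota> \<beta> \<longleftrightarrow> (\<forall>n\<ge>1. \<forall>r>0. \<forall>y. (\<forall>i<n. r \<le> norm (y i)) \<longrightarrow>
     r * real n powr \<beta> \<le> mat_norm X n (line_mat l n (\<lambda>i. \<iota> (y i))))"

text \<open>The radius \<open>3\<close> is the size of a rescaled row or column in \<open>line_growth_le\<close>; \<open>t\<close> is a distance that
  none of the maps collapses.\<close>

lemma equi_coarse_embeddingE:
  assumes "equi_coarse_embedding A d B e F"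
  obtains W t where "t \<ge> 1"
    "\<And>n x y. n \<ge> 1 \<Longrightarrow> x \<in> A n \<Longrightarrow> y \<in> A n \<Longrightarrow> d n x y \<le> 3 \<Longrightarrow> e n (F n x) (F n y) \<le> W"
    "\<And>n x y. n \<ge> 1 \<Longrightarrow> x \<in> A n \<Longrightarrow> y \<in> A n \<Longrightarrow> t \<le> d n x y \<Longrightarrow> 1 \<le> e n (F n x) (F n y)"
proof -
  have "expansion_modulus A d e F 3 < \<infinity>" using assms by (simp add: equi_coarse_embedding_def)
  then obtain W where W: "expansion_modulus A d e F 3 = ennreal W" "W \<ge> 0"
    by (cases "expansion_modulus A d e F 3") auto
  have up: "e n (F n x) (F n y) \<le> W" if "n \<ge> 1" "x \<in> A n" "y \<in> A n" "d n x y \<le> 3" for n x y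
  proof -
    have "ennreal (e n (F n x) (F n y))
        \<le> Sup {ennreal (e n (F n x) (F n y)) | x y. x \<in> A n \<and> y \<in> A n \<and> d n x y \<le> 3}"
      using that by (intro Sup_upper) blast
    also have "\<dots> \<le> expansion_modulus A d e F 3"
      unfolding expansion_modulus_def using that(1) by (intro SUP_upper) simp
    finally show ?thesis using W by (simp add: ennreal_le_iff)
  qed
  have "(compression_modulus A d e F \<longlongrightarrow> \<infinity>) at_top"
    using assms by (simp add: equi_coarse_embedding_def)
  then have "\<forall>\<^sub>F t in at_top. 1 < compression_modulus A d e F t"
    by (rule order_tendstoD) simp
  then have "\<forall>\<^sub>F t in at_top. 1 < compression_modulus A d e F t \<and> 1 \<le> t"
    by (intro eventually_conj eventually_ge_at_top)
  from eventually_happens[OF this] obtain t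
    where t: "1 < compression_modulus A d e F t" "t \<ge> 1" by auto
  have low: "1 \<le> e n (F n x) (F n y)" if "n \<ge> 1" "x \<in> A n" "y \<in> A n" "t \<le> d n x y" for n x y
  proof -
    have "compression_modulus A d e F t
        \<le> Inf {ennreal (e n (F n x) (F n y)) | x y. x \<in> A n \<and> y \<in> A n \<and> d n x y \<ge> t}"
      unfolding compression_modulus_def using that(1) by (intro INF_lower) simp
    also have "\<dots> \<le> ennreal (e n (F n x) (F n y))"
      using that by (intro Inf_lower) blast
    finally have "1 < ennreal (e n (F n x) (F n y))" using t(1) by (rule less_le_trans[rotated])
    then show ?thesis by simp
  qed
  show ?thesis by (rule that[OF t(2) up low])
qed

lemma amplification_block_diff:
  assumes "k \<le> n"
  shows "amplification n f (block k a) - amplification n f 0 = block k (f a - f (0::'a::ab_group_add) :: 'b::ab_group_add)"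
  using assms by (auto simp: fun_eq_iff amplification_def block_def)

lemma amplification_line_mat_diff:
  assumes "n \<ge> 1"
  shows "amplification n f (line_mat l n y) - amplification n f 0
    = line_mat l n (\<lambda>i. f (y i) - f (0::'a::ab_group_add) :: 'b::ab_group_add)"
  using assms by (cases l) (auto simp: fun_eq_iff amplification_def line_mat_def)

text \<open>A block of equal entries shows that \<open>f n\<close> moves \<open>s * e i\<close> away from \<open>f n 0\<close> by at least
  \<open>s / (6 * t)\<close>, for \<open>s\<close> as small as \<open>n powr (- \<alpha>)\<close>: this needs blocks of size about \<open>t / s\<close>, which fit into
  \<open>n \<times> n\<close> matrices for large \<open>n\<close> since \<open>\<alpha> < 1\<close>. The row or column of these vectors then has bounded
  norm, while its image grows like \<open>n powr (\<beta> - \<alpha>)\<close>.\<close>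

lemma no_embedding_of_line_growth:
  assumes X: "hilbertian X \<iota>" and Y: "hilbertian Y \<kappa>"
    and le: "line_growth_le l X \<iota> \<alpha>" and ge: "line_growth_ge l Y \<kappa> \<beta>"
    and \<alpha>: "0 \<le> \<alpha>" "\<alpha> < 1" and \<alpha>\<beta>: "\<alpha> < \<beta>"
  shows "\<not> bounded_subsets_almost_completely_coarsely_embed X Y"
proof
  assume "bounded_subsets_almost_completely_coarsely_embed X Y"
  then obtain f where emb: "equi_coarse_embedding (\<lambda>n. mat_ball X n (real n)) (mat_dist X)
      (\<lambda>n. mats n (vecs Y)) (mat_dist Y) (\<lambda>n. amplification n (f n))"
    unfolding bounded_subsets_almost_completely_coarsely_embed_def by blast
  then have maps: "amplification n (f n) A \<in> mats n (vecs Y)" if "n \<ge> 1" "A \<in> mat_ball X n n" for n A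
    using that by (auto simp: equi_coarse_embedding_def)
  obtain W t where t: "t \<ge> 1"
    and up: "\<And>n A B. n \<ge> 1 \<Longrightarrow> A \<in> mat_ball X n n \<Longrightarrow> B \<in> mat_ball X n n \<Longrightarrow> mat_dist X n A B \<le> 3 \<Longrightarrow>
      mat_dist Y n (amplification n (f n) A) (amplification n (f n) B) \<le> W"
    and low: "\<And>n A B. n \<ge> 1 \<Longrightarrow> A \<in> mat_ball X n n \<Longrightarrow> B \<in> mat_ball X n n \<Longrightarrow> t \<le> mat_dist X n A B \<Longrightarrow>
      1 \<le> mat_dist Y n (amplification n (f n) A) (amplification n (f n) B)"
    using emb by (rule equi_coarse_embeddingE) (rule that)
  have \<iota>: "\<iota> (a - b) = \<iota> a - \<iota> b" and vX: "vecs X = range \<iota>" for a b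
    using X unfolding hilbertian_def by blast+
  have \<iota>0: "\<iota> 0 = 0" using \<iota>[of 0 0] by simp
  have memX: "\<iota> a \<in> vecs X" "0 \<in> vecs X" for a
    unfolding vX using rangeI[of \<iota> 0] by (simp_all add: \<iota>0)
  have \<kappa>: "\<kappa> (a - b) = \<kappa> a - \<kappa> b" and vY: "vecs Y = range \<kappa>" for a b
    using Y unfolding hilbertian_def by blast+
  have blockX: "k * norm a \<le> mat_norm X n (block k (\<iota> a))" "mat_norm X n (block k (\<iota> a)) \<le> 3 * (k * norm a)"
    if "1 \<le> k" "k \<le> n" for n k a using X that unfolding hilbertian_def by blast+
  have blockY: "mat_norm Y n (block k (\<kappa> a)) \<le> 3 * (k * norm a)"
    if "1 \<le> k" "k \<le> n" for n k a using Y that unfolding hilbertian_def by blast+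
  have bound: "real n powr (\<beta> - \<alpha>) \<le> 6 * t * W"
    if n: "n \<ge> 3" and large: "6 * t \<le> real n powr (1 - \<alpha>)" for n
  proof -
    \<comment> \<open>The scale at which a row or column of \<open>n\<close> vectors \<open>s *\<^sub>R unit_vec i\<close> has norm at most \<open>3\<close>.\<close>
    define s where "s = real n powr (- \<alpha>)"
    have n1: "n \<ge> 1" using n by simp
    have s: "0 < s" "s \<le> 1"
      using n \<alpha> by (auto simp: s_def powr_minus inverse_eq_divide divide_le_eq ge_one_powr_ge_zero)
    have n_eq: "real n powr (1 - \<alpha>) = n * s"
      using n by (simp add: s_def powr_diff powr_minus divide_inverse)
    \<comment> \<open>The size at which a block with entries of norm \<open>s\<close> reaches distance \<open>t\<close> from \<open>0\<close>.\<close>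
    define k where "k = nat \<lceil>t / s\<rceil>"
    have ts: "t / s \<ge> 1" using s t by (simp add: le_divide_eq)
    have k: "t / s \<le> k" "k \<le> 2 * t / s" unfolding k_def using ts by linarith+
    have k1: "1 \<le> k" using k(1) ts by linarith
    have ks: "t \<le> k * s" "k * s \<le> 2 * t" using k s by (simp_all add: divide_le_eq le_divide_eq)
    have kn: "k \<le> n"
    proof -
      have "k * s \<le> n * s" using ks(2) large t n_eq by linarith
      then show ?thesis using s by simp
    qed
    have tn: "6 * t \<le> n" using large n_eq mult_left_mono[OF s(2), of "real n"] by simp
    have zero: "0 \<in> mat_ball X n n"
    proof -
      have "block 1 (\<iota> 0) = 0" by (auto simp: block_def \<iota>0 fun_eq_iff)
      then have "mat_norm X n 0 \<le> 0" using blockX(2)[of 1 n 0] n1 by simp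
      then show ?thesis
        using memX by (simp add: mat_ball_def mats_def)
    qed
    let ?x = "\<lambda>i. \<iota> (s *\<^sub>R unit_vec i)"
    have "\<exists>y. \<kappa> y = f n (?x i) - f n 0 \<and> s \<le> 6 * t * norm y" for i
    proof -
      have norm: "norm (s *\<^sub>R unit_vec i) = s" using s by simp
      have ball: "block k (?x i) \<in> mat_ball X n n"
        using blockX(2)[OF k1 kn, of "s *\<^sub>R unit_vec i"] ks tn kn memX unfolding norm
        by (auto simp: mat_ball_def mats_def block_def)
      have "f n (?x i) \<in> vecs Y" "f n 0 \<in> vecs Y"
        using maps[OF n1 ball] maps[OF n1 zero] k1 n1
        by (auto simp: mats_def amplification_def block_def split: if_splits dest!: spec[of _ 0])
      then obtain u v where "f n (?x i) = \<kappa> u" "f n 0 = \<kappa> v" unfolding vY by blast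
      then have y: "\<kappa> (u - v) = f n (?x i) - f n 0" by (simp add: \<kappa>)
      have "t \<le> mat_dist X n (block k (?x i)) 0"
        using blockX(1)[OF k1 kn, of "s *\<^sub>R unit_vec i"] ks(1) unfolding norm by (simp add: mat_dist_def)
      then have "1 \<le> mat_norm Y n (block k (\<kappa> (u - v)))"
        using low[OF n1 ball zero] by (simp add: mat_dist_def amplification_block_diff[OF kn] y)
      then have "1 \<le> 3 * (k * norm (u - v))" using blockY[OF k1 kn, of "u - v"] by linarith
      then have "s * 1 \<le> s * (3 * (k * norm (u - v)))" using s by (intro mult_left_mono) auto
      also have "\<dots> = 3 * (k * s) * norm (u - v)" by simp
      also have "\<dots> \<le> 3 * (2 * t) * norm (u - v)" using ks(2) by (intro mult_right_mono mult_left_mono) auto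
      finally show ?thesis using y by (intro exI[of _ "u - v"]) simp
    qed
    then obtain y where y: "\<And>i. \<kappa> (y i) = f n (?x i) - f n 0" "\<And>i. s \<le> 6 * t * norm (y i)" by metis
    have "mat_norm X n (line_mat l n ?x) \<le> 3 * s * real n powr \<alpha>"
      using le n1 s(1) by (simp add: line_growth_le_def)
    moreover have "s * real n powr \<alpha> = 1" using n by (simp add: s_def powr_add[symmetric])
    ultimately have norm: "mat_norm X n (line_mat l n ?x) \<le> 3" by (simp add: mult.assoc)
    have ball: "line_mat l n ?x \<in> mat_ball X n n"
      using norm n memX by (cases l) (auto simp: mat_ball_def mats_def line_mat_def)
    have "mat_dist Y n (amplification n (f n) (line_mat l n ?x)) (amplification n (f n) 0) \<le> W"
      using norm by (intro up[OF n1 ball zero]) (simp add: mat_dist_def)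
    then have "mat_norm Y n (line_mat l n (\<lambda>i. \<kappa> (y i))) \<le> W"
      by (simp add: mat_dist_def amplification_line_mat_diff[OF n1] y(1))
    moreover have "s / (6 * t) * real n powr \<beta> \<le> mat_norm Y n (line_mat l n (\<lambda>i. \<kappa> (y i)))"
    proof -
      have "s / (6 * t) > 0" "\<forall>i<n. s / (6 * t) \<le> norm (y i)"
        using s t y(2) by (auto simp: divide_le_eq mult.commute)
      then show ?thesis using ge n1 unfolding line_growth_ge_def by blast
    qed
    moreover have "real n powr (\<beta> - \<alpha>) = s * real n powr \<beta>"
      by (simp add: s_def powr_diff powr_minus divide_inverse mult.commute)
    ultimately have "real n powr (\<beta> - \<alpha>) / (6 * t) \<le> W" by simp
    then show ?thesis using t by (simp add: divide_le_eq mult.commute)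
  qed
  have pow: "filterlim (\<lambda>n. real n powr p) at_top sequentially" if "p > 0" for p
    using that by real_asymp
  have "\<forall>\<^sub>F n in sequentially. 6 * t * W < real n powr (\<beta> - \<alpha>) \<and> 6 * t < real n powr (1 - \<alpha>) \<and> n \<ge> 3"
    using pow[of "\<beta> - \<alpha>"] pow[of "1 - \<alpha>"] \<alpha> \<alpha>\<beta>
    by (intro eventually_conj eventually_ge_at_top) (auto simp: filterlim_at_top_dense)
  from eventually_happens[OF this] obtain n
    where "6 * t * W < real n powr (\<beta> - \<alpha>)" "6 * t < real n powr (1 - \<alpha>)" "n \<ge> 3" by auto
  with bound[of n] show False by simp
qed

section \<open>Growth exponents of the row and the column space\<close>

text \<open>Pairing a matrix with its own conjugate gives the square of its Hilbert-Schmidt norm \<open>a\<close>; a dual bound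
  is then divided by \<open>a\<close>.\<close>

lemma le_of_square_le_mult:
  fixes a c N :: real
  assumes "a\<^sup>2 \<le> c * a * N" "a > 0"
  shows "a \<le> c * N"
  using assms by (simp add: power2_eq_square mult.assoc mult.left_commute)

lemma block_pairing_block: "cmod (block_pairing k (conj_vec a) (block k a)) = (k * norm a)\<^sup>2"
  by (simp add: block_pairing_def block_def bidot_conj_vec power_mult_distrib power2_eq_square norm_mult)

lemma line_pairing_line_mat:
  "cmod (line_pairing l n (\<lambda>i. conj_vec (y i)) (line_mat l n y)) = (L2_set (\<lambda>i. norm (y i)) {..<n})\<^sup>2"
proof -
  have "line_pairing l n (\<lambda>i. conj_vec (y i)) (line_mat l n y) = (\<Sum>i<n. of_real ((norm (y i))\<^sup>2))"
    unfolding line_pairing_def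
    by (rule sum.cong) (auto simp: line_entry_def line_mat_def bidot_conj_vec split: line.split)
  also have "\<dots> = of_real ((L2_set (\<lambda>i. norm (y i)) {..<n})\<^sup>2)"
    by (simp add: L2_set_def sum_nonneg)
  finally show ?thesis by (simp only: norm_of_real) simp
qed

lemma L2_set_norm_ge:
  fixes n :: nat
  assumes "\<forall>i<n. r \<le> norm (y i)" "r > 0"
  shows "sqrt n * r \<le> L2_set (\<lambda>i. norm (y i)) {..<n}"
proof -
  have "sqrt n * r = L2_set (\<lambda>i. r) {..<n}" using assms(2) by (simp add: L2_set_constant)
  also have "\<dots> \<le> L2_set (\<lambda>i. norm (y i)) {..<n}" using assms by (intro L2_set_mono) auto
  finally show ?thesis .
qed

lemma map_block: "\<iota> 0 = 0 \<Longrightarrow> (\<lambda>i j. \<iota> (block k a i j)) = block k (\<iota> a)"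
  by (auto simp: block_def fun_eq_iff)

lemma map_line_mat: "\<iota> 0 = 0 \<Longrightarrow> (\<lambda>i j. \<iota> (line_mat l n y i j)) = line_mat l n (\<lambda>i. \<iota> (y i))"
  by (cases l) (auto simp: line_mat_def fun_eq_iff)

lemma mat_norm_R_space:
  "mat_norm R_space n (block k (row_op a)) = row_norm n (block k a)"
  "mat_norm R_space n (line_mat l n (\<lambda>i. row_op (y i))) = row_norm n (line_mat l n y)"
  by (simp_all add: R_space_def operator_space_def row_norm_def map_block map_line_mat)

lemma mat_norm_C_space:
  "mat_norm C_space n (block k (column_op a)) = column_norm n (block k a)"
  "mat_norm C_space n (line_mat l n (\<lambda>i. column_op (y i))) = column_norm n (line_mat l n y)"
  by (simp_all add: C_space_def operator_space_def column_norm_def map_block map_line_mat)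

lemma block_norm_bounds:
  assumes "k \<le> n"
  shows "k * norm a \<le> row_norm n (block k a)" "row_norm n (block k a) \<le> k * norm a"
    "k * norm a \<le> column_norm n (block k a)" "column_norm n (block k a) \<le> k * norm a"
proof -
  show "row_norm n (block k a) \<le> k * norm a" "column_norm n (block k a) \<le> k * norm a"
    using row_norm_le_frobenius column_norm_le_frobenius frobenius_block[OF assms] by metis+
  show "k * norm a \<le> row_norm n (block k a)"
  proof (cases "k * norm a = 0")
    case False
    then show ?thesis
      using block_pairing_le_row_norm[OF assms, of "conj_vec a" "block k a"]
        le_of_square_le_mult[of "k * norm a" 1] by (simp add: block_pairing_block)
  qed (use cseminormD(1)[OF cseminorm_row_norm, of n "block k a"] in linarith)
  show "k * norm a \<le> column_norm n (block k a)"
  proof (cases "k * norm a = 0")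
    case False
    then show ?thesis
      using block_pairing_le_column_norm[OF assms, of "conj_vec a" "block k a"]
        le_of_square_le_mult[of "k * norm a" 1] by (simp add: block_pairing_block)
  qed (use cseminormD(1)[OF cseminorm_column_norm, of n "block k a"] in linarith)
qed

lemma hilbertian_R_space: "hilbertian R_space row_op"
proof -
  have "row_op (a - b) = row_op a - row_op b" for a b using row_op_add[of "a - b" b] by simp
  moreover have "row_norm n (block k a) \<le> 3 * (k * norm a)" if "k \<le> n" for n k a
  proof -
    have "k * norm a \<ge> 0" by simp
    with block_norm_bounds(2)[OF that, of a] show ?thesis by linarith
  qed
  ultimately show ?thesis
    unfolding hilbertian_def mat_norm_R_space
    using block_norm_bounds(1) by (simp add: R_space_def operator_space_def row_space_eq)
qed

lemma hilbertian_C_space: "hilbertian C_space column_op"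
proof -
  have "column_op (a - b) = column_op a - column_op b" for a b using column_op_add[of "a - b" b] by simp
  moreover have "column_norm n (block k a) \<le> 3 * (k * norm a)" if "k \<le> n" for n k a
  proof -
    have "k * norm a \<ge> 0" by simp
    with block_norm_bounds(4)[OF that, of a] show ?thesis by linarith
  qed
  ultimately show ?thesis
    unfolding hilbertian_def mat_norm_C_space
    using block_norm_bounds(3) by (simp add: C_space_def operator_space_def column_space_eq)
qed

lemma line_growth_le_R_space: "line_growth_le Column R_space row_op 0"
  unfolding line_growth_le_def mat_norm_R_space
proof (intro allI impI)
  fix n :: nat and s :: real assume "1 \<le> n" "0 < s"
  with row_norm_column_le[of s n]
  show "row_norm n (line_mat Column n (\<lambda>i. s *\<^sub>R unit_vec i)) \<le> 3 * s * real n powr 0" by simp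
qed

lemma line_growth_le_C_space: "line_growth_le Row C_space column_op 0"
  unfolding line_growth_le_def mat_norm_C_space
proof (intro allI impI)
  fix n :: nat and s :: real assume "1 \<le> n" "0 < s"
  with column_norm_row_le[of s n]
  show "column_norm n (line_mat Row n (\<lambda>i. s *\<^sub>R unit_vec i)) \<le> 3 * s * real n powr 0" by simp
qed

lemma line_growth_ge_R_space: "line_growth_ge Row R_space row_op (1 / 2)"
  unfolding line_growth_ge_def mat_norm_R_space
proof (intro allI impI)
  fix n :: nat and r :: real and y :: "nat \<Rightarrow> ell2"
  assume n: "1 \<le> n" and r: "0 < r" and y: "\<forall>i<n. r \<le> norm (y i)"
  let ?Y = "L2_set (\<lambda>i. norm (y i)) {..<n}"
  have Y: "sqrt n * r \<le> ?Y" by (rule L2_set_norm_ge[OF y r])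
  have "sqrt n * r > 0" using n r by simp
  with Y have pos: "?Y > 0" by linarith
  have "?Y\<^sup>2 \<le> 1 * ?Y * row_norm n (line_mat Row n y)"
    using line_pairing_le_row_norm[of Row n "\<lambda>i. conj_vec (y i)" "line_mat Row n y"]
    by (simp add: line_pairing_line_mat)
  from le_of_square_le_mult[OF this pos] have "?Y \<le> row_norm n (line_mat Row n y)" by simp
  then show "r * real n powr (1 / 2) \<le> row_norm n (line_mat Row n y)"
    using Y by (simp add: powr_half_sqrt mult.commute)
qed

lemma line_growth_ge_C_space: "line_growth_ge Column C_space column_op (1 / 2)"
  unfolding line_growth_ge_def mat_norm_C_space
proof (intro allI impI)
  fix n :: nat and r :: real and y :: "nat \<Rightarrow> ell2"
  assume n: "1 \<le> n" and r: "0 < r" and y: "\<forall>i<n. r \<le> norm (y i)"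
  let ?Y = "L2_set (\<lambda>i. norm (y i)) {..<n}"
  have Y: "sqrt n * r \<le> ?Y" by (rule L2_set_norm_ge[OF y r])
  have "sqrt n * r > 0" using n r by simp
  with Y have pos: "?Y > 0" by linarith
  have "?Y\<^sup>2 \<le> 1 * ?Y * column_norm n (line_mat Column n y)"
    using line_pairing_le_column_norm[of Column n "\<lambda>i. conj_vec (y i)" "line_mat Column n y"]
    by (simp add: line_pairing_line_mat)
  from le_of_square_le_mult[OF this pos] have "?Y \<le> column_norm n (line_mat Column n y)" by simp
  then show "r * real n powr (1 / 2) \<le> column_norm n (line_mat Column n y)"
    using Y by (simp add: powr_half_sqrt mult.commute)
qed

section \<open>Growth exponents of the operator Hilbert space\<close>

lemma subspace_mats: "complex_vector.subspace (mats n (UNIV :: 'a::complex_vector set))"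
  by (rule complex_vector.subspaceI) (auto simp: mats_def scaleC_fun_def)

lemma block_in_mats: "k \<le> n \<Longrightarrow> block k a \<in> mats n UNIV"
  by (auto simp: mats_def block_def)

lemma line_mat_in_mats: "n \<ge> 1 \<Longrightarrow> line_mat l n y \<in> mats n UNIV"
  by (cases l) (auto simp: mats_def line_mat_def)

lemma vecs_transport_row_op: "vecs (transport row_op R_space) = UNIV"
  and vecs_transport_column_op: "vecs (transport column_op C_space) = UNIV"
  by (simp_all add: transport_def R_space_def C_space_def operator_space_def
      row_op_in_row_space column_op_in_column_space)

lemma mat_norm_OH_space:
  "mat_norm OH_space n = interp_norm (1 / 2) (mats n UNIV) (row_norm n) (mats n UNIV) (column_norm n)"
proof -
  have "mat_norm (transport row_op R_space) n = row_norm n"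
    "mat_norm (transport column_op C_space) n = column_norm n"
    by (simp_all add: fun_eq_iff transport_def R_space_def C_space_def operator_space_def
        row_norm_def column_norm_def)
  then show ?thesis
    by (simp add: OH_space_def interpolate_def vecs_transport_row_op vecs_transport_column_op)
qed

text \<open>Both norms of the couple are defined on all of \<open>\<ell>\<^sub>2\<close>, so interpolation neither adds nor removes vectors.\<close>

lemma vecs_OH_space: "vecs OH_space = UNIV"
proof -
  have mat_of: "mat_of (x + y) = mat_of x + mat_of y" "mat_of (c *\<^sub>C x) = c *\<^sub>C mat_of x" for x y :: ell2 and c
    by (auto simp: mat_of_def fun_eq_iff scaleC_fun_def)
  have semi: "cseminorm (\<lambda>x. N (mat_of x))" if "cseminorm N" for N :: "ell2 mat \<Rightarrow> real"
    using that by (simp add: cseminorm_def mat_of)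
  have "vec_norm (transport row_op R_space) = (\<lambda>x. row_norm 1 (mat_of x))"
    "vec_norm (transport column_op C_space) = (\<lambda>x. column_norm 1 (mat_of x))"
    by (simp_all add: fun_eq_iff vec_norm_def transport_def R_space_def C_space_def operator_space_def
        row_norm_def column_norm_def)
  then show ?thesis
    using interp_space_eq[OF complex_vector.subspace_UNIV semi[OF cseminorm_row_norm] semi[OF cseminorm_column_norm]]
    by (simp add: OH_space_def interpolate_def vecs_transport_row_op vecs_transport_column_op)
qed

lemmas OH_norm_le = interp_norm_le[OF subspace_mats[of n] cseminorm_row_norm[of n] cseminorm_column_norm[of n],
    folded mat_norm_OH_space] for n

lemmas functional_le_OH_norm =
  functional_le_interp_norm[OF subspace_mats[of n] cseminorm_row_norm[of n] cseminorm_column_norm[of n],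
    folded mat_norm_OH_space] for n

lemma block_OH_norm_bounds:
  assumes k: "1 \<le> k" "k \<le> n"
  shows "k * norm a \<le> mat_norm OH_space n (block k a)"
    and "mat_norm OH_space n (block k a) \<le> 3 * (k * norm a)"
proof -
  show up: "mat_norm OH_space n (block k a) \<le> 3 * (k * norm a)"
  proof (rule field_le_epsilon)
    fix e :: real assume e: "e > 0"
    define m where "m = k * norm a + e / 3"
    have m: "m > 0" "k * norm a \<le> m" using e by (auto simp: m_def add_nonneg_pos)
    have "mat_norm OH_space n (block k a) \<le> 3 * sqrt (m * m)"
      using m block_norm_bounds(2,4)[OF k(2), of a]
      by (intro OH_norm_le block_in_mats k) linarith+
    also have "\<dots> = 3 * (k * norm a) + e" using m by (simp add: m_def)
    finally show "mat_norm OH_space n (block k a) \<le> 3 * (k * norm a) + e" .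
  qed
  show "k * norm a \<le> mat_norm OH_space n (block k a)"
  proof (cases "a = 0")
    case True
    \<comment> \<open>The zero functional shows that the interpolated norm is nonnegative.\<close>
    have "cmod 0 \<le> sqrt (1 * 1) * mat_norm OH_space n (block k a)"
      using cseminormD(1)[OF cseminorm_row_norm] cseminormD(1)[OF cseminorm_column_norm]
      by (intro functional_le_OH_norm[of "\<lambda>_. 0"] block_in_mats k) simp_all
    then show ?thesis by (simp add: True)
  next
    case False
    then have pos: "k * norm a > 0" using k by simp
    have "cmod (block_pairing k (conj_vec a) (block k a))
        \<le> sqrt ((k * norm a) * (k * norm a)) * mat_norm OH_space n (block k a)"
      using block_pairing_le_row_norm[OF k(2), of "conj_vec a"] block_pairing_le_column_norm[OF k(2), of "conj_vec a"] pos
      by (intro functional_le_OH_norm block_pairing_add block_pairing_scaleC block_in_mats k) simp_all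
    then have "(k * norm a)\<^sup>2 \<le> 1 * (k * norm a) * mat_norm OH_space n (block k a)"
      using pos by (simp add: block_pairing_block)
    then show ?thesis using le_of_square_le_mult[OF _ pos] by fastforce
  qed
qed

lemma hilbertian_OH_space: "hilbertian OH_space (\<lambda>a. a)"
  unfolding hilbertian_def using block_OH_norm_bounds by (simp add: vecs_OH_space)

lemma sqrt_sqrt_eq_powr: "x \<ge> 0 \<Longrightarrow> sqrt (sqrt x) = x powr (1 / 4)"
  by (simp add: powr_half_sqrt[symmetric] powr_powr)

lemma line_growth_le_OH_space: "line_growth_le l OH_space (\<lambda>a. a) (1 / 4)"
  unfolding line_growth_le_def
proof (intro allI impI)
  fix n :: nat and s :: real assume n: "1 \<le> n" and s: "0 < s"
  let ?A = "line_mat l n (\<lambda>i. s *\<^sub>R unit_vec i)"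
  have fro: "frobenius n ?A = sqrt n * s"
    using s by (simp add: frobenius_line_mat[OF n] L2_set_constant)
  \<comment> \<open>One of the two norms is at most \<open>s\<close>, the other one at most the Hilbert-Schmidt norm \<open>sqrt n * s\<close>; the geometric
    mean of these bounds has the exponent \<open>1/4\<close>.\<close>
  have "\<exists>m0 m1. row_norm n ?A \<le> m0 \<and> column_norm n ?A \<le> m1 \<and> m0 > 0 \<and> m1 > 0 \<and> m0 * m1 = s\<^sup>2 * sqrt n"
  proof (cases l)
    case Row
    then show ?thesis
      using row_norm_le_frobenius[of n ?A] column_norm_row_le[of s n] n s unfolding fro
      by (intro exI[of _ "sqrt n * s"] exI[of _ s]) (simp add: power2_eq_square)
  next
    case Column
    then show ?thesis
      using column_norm_le_frobenius[of n ?A] row_norm_column_le[of s n] n s unfolding fro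
      by (intro exI[of _ s] exI[of _ "sqrt n * s"]) (simp add: power2_eq_square)
  qed
  then obtain m0 m1 where m: "row_norm n ?A \<le> m0" "column_norm n ?A \<le> m1" "m0 > 0" "m1 > 0" "m0 * m1 = s\<^sup>2 * sqrt n"
    by blast
  have "mat_norm OH_space n ?A \<le> 3 * sqrt (m0 * m1)"
    by (rule OH_norm_le[OF line_mat_in_mats[OF n] m(1-4)])
  also have "\<dots> = 3 * s * real n powr (1 / 4)"
    using s by (simp add: m(5) real_sqrt_mult sqrt_sqrt_eq_powr)
  finally show "mat_norm OH_space n ?A \<le> 3 * s * real n powr (1 / 4)" .
qed

lemma line_growth_ge_OH_space: "line_growth_ge l OH_space (\<lambda>a. a) (1 / 4)"
  unfolding line_growth_ge_def
proof (intro allI impI)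
  fix n :: nat and r :: real and y :: "nat \<Rightarrow> ell2"
  assume n: "1 \<le> n" and r: "0 < r" and y: "\<forall>i<n. r \<le> norm (y i)"
  let ?Y = "L2_set (\<lambda>i. norm (y i)) {..<n}" and ?N = "mat_norm OH_space n (line_mat l n y)"
  define w where "w = real n powr (1 / 4)"
  have w: "w > 0" "sqrt (sqrt n) = w" "w * w = sqrt n"
    using n by (auto simp: w_def sqrt_sqrt_eq_powr powr_add[symmetric] powr_half_sqrt)
  have Y: "sqrt n * r \<le> ?Y" by (rule L2_set_norm_ge[OF y r])
  have "sqrt n * r > 0" using n r by simp
  with Y have Ypos: "?Y > 0" by linarith
  have "?Y\<^sup>2 \<le> w * ?Y * ?N"
  proof -
    \<comment> \<open>Whichever of the bounds carries the factor \<open>sqrt n\<close>, the geometric mean carries its square root \<open>w\<close>.\<close>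
    let ?M0 = "(case l of Row \<Rightarrow> 1 | Column \<Rightarrow> sqrt n) * ?Y" and ?M1 = "(case l of Row \<Rightarrow> sqrt n | Column \<Rightarrow> 1) * ?Y"
    have "cmod (line_pairing l n (\<lambda>i. conj_vec (y i)) (line_mat l n y)) \<le> sqrt (?M0 * ?M1) * ?N"
      using line_pairing_le_row_norm[of l n "\<lambda>i. conj_vec (y i)"]
        line_pairing_le_column_norm[of l n "\<lambda>i. conj_vec (y i)"] Ypos n
      by (intro functional_le_OH_norm line_pairing_add line_pairing_scaleC line_mat_in_mats)
        (simp_all split: line.split)
    moreover have "?M0 * ?M1 = sqrt n * ?Y\<^sup>2" by (cases l) (simp_all add: power2_eq_square)
    then have "sqrt (?M0 * ?M1) = w * ?Y" by (simp add: real_sqrt_mult w)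
    ultimately show ?thesis by (simp add: line_pairing_line_mat)
  qed
  from le_of_square_le_mult[OF this Ypos] have "w * (r * w) \<le> w * ?N"
    using Y w(3) by (simp add: mult_ac)
  then show "r * real n powr (1 / 4) \<le> ?N" using w(1) by (simp add: w_def[symmetric])
qed

section \<open>Incomparability\<close>

theorem corollary1p4:
  shows "\<not> bounded_subsets_almost_completely_coarsely_embed R_space C_space \<and>
         \<not> bounded_subsets_almost_completely_coarsely_embed C_space R_space \<and>
         \<not> bounded_subsets_almost_completely_coarsely_embed R_space OH_space \<and>
         \<not> bounded_subsets_almost_completely_coarsely_embed OH_space R_space \<and>
         \<not> bounded_subsets_almost_completely_coarsely_embed C_space OH_space \<and>
         \<not> bounded_subsets_almost_completely_coarsely_embed OH_space C_space"
proof (intro conjI)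
  note R = hilbertian_R_space and C = hilbertian_C_space and OH = hilbertian_OH_space
  show "\<not> bounded_subsets_almost_completely_coarsely_embed R_space C_space"
    by (rule no_embedding_of_line_growth[OF R C line_growth_le_R_space line_growth_ge_C_space]) simp_all
  show "\<not> bounded_subsets_almost_completely_coarsely_embed C_space R_space"
    by (rule no_embedding_of_line_growth[OF C R line_growth_le_C_space line_growth_ge_R_space]) simp_all
  show "\<not> bounded_subsets_almost_completely_coarsely_embed R_space OH_space"
    by (rule no_embedding_of_line_growth[OF R OH line_growth_le_R_space line_growth_ge_OH_space]) simp_all
  show "\<not> bounded_subsets_almost_completely_coarsely_embed OH_space R_space"
    by (rule no_embedding_of_line_growth[OF OH R line_growth_le_OH_space line_growth_ge_R_space]) simp_all
  show "\<not> bounded_subsets_almost_completely_coarsely_embed C_space OH_space"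
    by (rule no_embedding_of_line_growth[OF C OH line_growth_le_C_space line_growth_ge_OH_space]) simp_all
  show "\<not> bounded_subsets_almost_completely_coarsely_embed OH_space C_space"
    by (rule no_embedding_of_line_growth[OF OH C line_growth_le_OH_space line_growth_ge_C_space]) simp_all
qed

end
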